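(* Let $G$ be a grid graph (not necessarily simple). Then $$\tau(G)\geq\mathfrak{b}^m,\qquad\text{where } m = |V(G)|- |\hat{\partial} G|.$$
   Context: $V(G)$ is the vertex set of $G$ and $\tau(G)$ is the number of spanning trees of a finite connected graph $G$. The constant is $\mathfrak{b}=\exp(4C/\pi)\approx 3.2099$, where $C=\sum_{n\ge 0}\frac{(-1)^n}{(2n+1)^2}$ is Catalan's constant. $\mathcal{L}(\mathbb{Z}^2)$ is the regular square lattice graph: its vertex set is $\mathbb{Z}^2$ and its edges join points at Euclidean distance $1$. A grid graph is a finite connected subgraph of $\mathcal{L}(\mathbb{Z}^2)$. For $v=(x,y)\in V(G)$, let ${}^\Box v$ denote the subgraph of $\mathcal{L}(\mathbb{Z}^2)$ comprised of the four vertices and four edges of the $1$-by-$1$ square whose bottom-right corner is $v$ (vertices $(x,y),(x-1,y),(x-1,y+1),(x,y+1)$). The top-left boundary of $G$ is $\hat{\partial} G = \{v\in V(G)\mid {}^\Box v\text{ is not a subgraph of }G\}$. *)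

theory Defs
  imports "HOL-Analysis.Analysis" "Graph_Theory.Graph_Theory"
begin

text \<open>
  Finite simple graphs are finite, loop-free, symmetric pair digraphs (locale
  \<^locale>\<open>pair_graph\<close>): an undirected edge is a pair of opposite arcs.
  The library predicates \<^const>\<open>forest\<close>, \<^const>\<open>tree\<close> and
  \<^const>\<open>spanning_tree\<close> forbid directed cycles only. On a symmetric digraph they
  already reject a single undirected edge (the closed walk u, v, u counts as a cycle),
  so undirected versions are defined here. In a loop-free graph without parallel edges,
  the cycles in the undirected sense are those of length at least 3.
\<close>

definition undirected_tree :: "'a pair_pre_digraph \<Rightarrow> bool" where
  "undirected_tree T \<longleftrightarrow> pair_graph T \<and> Digraph_Component.connected (with_proj T) \<and>
     \<not> (\<exists>p. pre_digraph.cycle (with_proj T) p \<and> 3 \<le> length p)"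

definition spanning_trees :: "'a pair_pre_digraph \<Rightarrow> 'a pair_pre_digraph set" where
  "spanning_trees G = {T. undirected_tree T \<and> spanning (with_proj T) (with_proj G)}"

definition num_spanning_trees :: "'a pair_pre_digraph \<Rightarrow> nat" (\<open>\<tau>\<close>) where
  "\<tau> G = card (spanning_trees G)"

definition to_plane :: "int \<times> int \<Rightarrow> real \<times> real" where
  "to_plane v = (real_of_int (fst v), real_of_int (snd v))"

text \<open>The metric on \<^typ>\<open>real \<times> real\<close> is the Euclidean one.\<close>

definition square_lattice :: "(int \<times> int) pair_pre_digraph" where
  "square_lattice = \<lparr> pverts = UNIV, parcs = {(u, v). dist (to_plane u) (to_plane v) = 1} \<rparr>"

text \<open>A connected graph is nonempty by the library's definition.\<close>

definition grid_graph :: "(int \<times> int) pair_pre_digraph \<Rightarrow> bool" where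
  "grid_graph G \<longleftrightarrow> pair_graph G \<and> subgraph (with_proj G) (with_proj square_lattice) \<and>
     Digraph_Component.connected (with_proj G)"

fun unit_square :: "int \<times> int \<Rightarrow> (int \<times> int) pair_pre_digraph" where
  "unit_square (x, y) =
     (let E = {((x, y), (x - 1, y)), ((x - 1, y), (x - 1, y + 1)),
               ((x - 1, y + 1), (x, y + 1)), ((x, y + 1), (x, y))}
      in \<lparr> pverts = {(x, y), (x - 1, y), (x - 1, y + 1), (x, y + 1)}, parcs = E \<union> E\<inverse> \<rparr>)"

definition top_left_boundary :: "(int \<times> int) pair_pre_digraph \<Rightarrow> (int \<times> int) set" where
  "top_left_boundary G = {v \<in> pverts G. \<not> subgraph (with_proj (unit_square v)) (with_proj G)}"

definition catalan_const :: real where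
  "catalan_const = (\<Sum>n::nat. (- 1) ^ n / (2 * real n + 1)\<^sup>2)"

definition lattice_const :: real (\<open>\<bb>\<close>) where
  "\<bb> = exp (4 * catalan_const / pi)"

end

theory Submission
  imports Defs "HOL-Complex_Analysis.Complex_Analysis" "HOL-Real_Asymp.Real_Asymp"
begin

text \<open>
  Write \<open>b\<close> for the lattice constant. The spanning trees are counted by deleting one edge at a
  time. If the edge \<open>uw\<close> is not a bridge of \<open>E\<close>, then the number of spanning trees drops under its
  deletion by a factor equal to the energy of a circulation \<open>\<theta>\<close> with \<open>\<theta> u w = 1\<close>, the electrical
  current driven round the edge (\<open>deletion_flow\<close>).
  Hence it suffices to delete the edges in such an order that every unit circulation through the
  edge that is being deleted has energy at least \<open>b\<close>.

  The order is lexicographic: let \<open>v\<close> be the last vertex on a non-bridge edge, where lower rows come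
  later and, within a row, points further to the right. A circulation vanishes on bridges, so it
  lives on the edges between vertices up to \<open>v\<close>. Every circulation on the square lattice is the
  rotated gradient of a finitely supported function \<open>f\<close> on the unit squares, and its energy is the
  Dirichlet energy of \<open>f\<close> (\<open>circulation_energy\<close>). Here \<open>f\<close> vanishes on every square whose
  bottom-right corner comes after \<open>v\<close>, and \<open>f = 1\<close> or \<open>f = -1\<close> on the square at \<open>v\<close>, because the left
  and the upper edge are the only edges at \<open>v\<close> that carry flow.

  That such an \<open>f\<close> has Dirichlet energy at least \<open>b\<close> is Szego's theorem for a half-plane of
  lattice points (\<open>half_plane_energy\<close>). A Fourier transform along the rows diagonalises the
  horizontal part; completing squares row by row from the top then eliminates all rows but the
  lowest and leaves the weight \<open>exp (2 * arsinh \<bar>sin (s / 2)\<bar>)\<close> on the lowest one. The lowest row is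
  one-sided, hence a polynomial \<open>p\<close> on the unit circle with \<open>\<bar>p(0)\<bar> = 1\<close>, and the one-dimensional
  Szego bound (\<open>szego_lower_bound\<close>) gives the geometric mean of the weight. The geometric mean is
  \<open>b\<close> because \<open>arsinh (sin t)\<close> integrates to Catalan's constant over \<open>{0..pi/2}\<close>
  (\<open>integral_arsinh_sin\<close>).

  One deletion destroys at most one unit square of the graph, namely the one at \<open>v\<close>, and a connected graph
  all of whose edges are bridges has no unit squares and one spanning tree. So the number of spanning
  trees is at least \<open>b\<close> to the number of unit squares (\<open>grid_tree_bound\<close>).
\<close>

section \<open>Spanning trees as minimal connecting arc sets\<close>

definition add_edge :: "('a \<times> 'a) set \<Rightarrow> 'a \<Rightarrow> 'a \<Rightarrow> ('a \<times> 'a) set" where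
  "add_edge E x y = insert (x, y) (insert (y, x) E)"

definition del_edge :: "('a \<times> 'a) set \<Rightarrow> 'a \<Rightarrow> 'a \<Rightarrow> ('a \<times> 'a) set" where
  "del_edge E x y = E - {(x, y), (y, x)}"

definition connects :: "'a set \<Rightarrow> ('a \<times> 'a) set \<Rightarrow> bool" where
  "connects V E \<longleftrightarrow> (\<forall>x\<in>V. \<forall>y\<in>V. (x, y) \<in> E\<^sup>*)"

definition is_bridge :: "('a \<times> 'a) set \<Rightarrow> 'a \<Rightarrow> 'a \<Rightarrow> bool" where
  "is_bridge E x y \<longleftrightarrow> (x, y) \<notin> (del_edge E x y)\<^sup>*"

text \<open>
  An undirected graph is a symmetric set of arcs. A tree is taken to be a connecting set of edges all
  of which are bridges; this form suits deletion and exchange arguments, which only ask what is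
  reachable once a single edge is gone.
\<close>

definition trees :: "'a set \<Rightarrow> ('a \<times> 'a) set \<Rightarrow> ('a \<times> 'a) set set" where
  "trees V E = {T. T \<subseteq> E \<and> sym T \<and> connects V T \<and> (\<forall>(x, y)\<in>T. is_bridge T x y)}"

lemma sym_edge_ops: "sym E \<Longrightarrow> sym (del_edge E x y)" "sym E \<Longrightarrow> sym (add_edge E x y)"
  unfolding sym_def del_edge_def add_edge_def by blast+

lemma del_edge_commute: "del_edge E x y = del_edge E y x"
  by (auto simp: del_edge_def)

lemma del_edge_subset: "del_edge E x y \<subseteq> E"
  by (auto simp: del_edge_def)

lemma add_del_edge: "sym E \<Longrightarrow> (x, y) \<in> E \<Longrightarrow> add_edge (del_edge E x y) x y = E"
  unfolding sym_def del_edge_def add_edge_def by blast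

lemma del_add_edge: "sym E \<Longrightarrow> (x, y) \<notin> E \<Longrightarrow> del_edge (add_edge E x y) x y = E"
  unfolding sym_def del_edge_def add_edge_def by blast

lemma sym_rtranclD: "sym R \<Longrightarrow> (a, b) \<in> R\<^sup>* \<Longrightarrow> (b, a) \<in> R\<^sup>*"
  by (blast dest: sym_rtrancl symD)

lemma is_bridge_commute: "sym E \<Longrightarrow> is_bridge E x y = is_bridge E y x"
  unfolding is_bridge_def del_edge_commute[of E y x]
  by (blast intro: sym_rtranclD[OF sym_edge_ops(1)])

lemma treesD:
  assumes "T \<in> trees V E"
  shows "T \<subseteq> E" "sym T" "connects V T" "(x, y) \<in> T \<Longrightarrow> (x, y) \<notin> (del_edge T x y)\<^sup>*"
  using assms unfolding trees_def is_bridge_def by blast+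

text \<open>
  A walk that uses the new edge several times can be cut down to one that uses it once.
\<close>

lemma rtrancl_add_edge_cases:
  assumes "(a, b) \<in> (add_edge R u w)\<^sup>*"
  shows "(a, b) \<in> R\<^sup>* \<or> ((a, u) \<in> R\<^sup>* \<and> (w, b) \<in> R\<^sup>*) \<or> ((a, w) \<in> R\<^sup>* \<and> (u, b) \<in> R\<^sup>*)"
  using assms
proof (induction rule: rtrancl_induct)
  case (step b c)
  from step.hyps(2) consider "(b, c) \<in> R" | "b = u" "c = w" | "b = w" "c = u"
    by (auto simp: add_edge_def)
  then show ?case
  proof cases
    case 1
    with step.IH show ?thesis by (meson rtrancl_into_rtrancl)
  next
    case 2
    with step.IH show ?thesis by blast
  next
    case 3
    with step.IH show ?thesis by blast
  qed
qed auto

lemma connects_del_nonbridge: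
  assumes "connects V E" "sym E" "\<not> is_bridge E x y"
  shows "connects V (del_edge E x y)"
  unfolding connects_def
proof (intro ballI)
  let ?R = "del_edge E x y"
  fix a b assume "a \<in> V" "b \<in> V"
  then have "(a, b) \<in> E\<^sup>*" using assms by (auto simp: connects_def)
  moreover have "E \<subseteq> add_edge ?R x y" by (auto simp: add_edge_def del_edge_def)
  ultimately have "(a, b) \<in> (add_edge ?R x y)\<^sup>*" using rtrancl_mono by blast
  moreover have xy: "(x, y) \<in> ?R\<^sup>*" using assms by (simp add: is_bridge_def)
  moreover have "(y, x) \<in> ?R\<^sup>*" using xy assms sym_rtranclD sym_edge_ops by metis
  ultimately show "(a, b) \<in> ?R\<^sup>*"
    using rtrancl_add_edge_cases rtrancl_trans by metis
qed

lemma trees_nonempty: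
  assumes "finite E" "sym E" "connects V E"
  shows "trees V E \<noteq> {}"
  using assms
proof (induction "card E" arbitrary: E rule: less_induct)
  case less
  show ?case
  proof (cases "\<forall>(x, y)\<in>E. is_bridge E x y")
    case True
    then have "E \<in> trees V E" using less.prems by (auto simp: trees_def)
    then show ?thesis by blast
  next
    case False
    then obtain x y where xy: "(x, y) \<in> E" "\<not> is_bridge E x y" by auto
    have "card (del_edge E x y) < card E"
      using xy less.prems by (intro psubset_card_mono) (auto simp: del_edge_def)
    then have "trees V (del_edge E x y) \<noteq> {}"
      using less connects_del_nonbridge xy sym_edge_ops
      by (metis del_edge_subset finite_subset)
    moreover have "trees V (del_edge E x y) \<subseteq> trees V E"
      by (auto simp: trees_def del_edge_def)
    ultimately show ?thesis by blast
  qed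
qed

lemma finite_trees: "finite E \<Longrightarrow> finite (trees V E)"
  by (rule finite_subset[of _ "Pow E"]) (auto dest: treesD(1))

text \<open>
  Removing an edge splits the tree into the side of \<open>x\<close> and the side of \<open>y\<close>.
\<close>

lemma tree_sides:
  assumes T: "T \<in> trees V E" and xy: "(x, y) \<in> T" and z: "z \<in> V" and x: "x \<in> V"
  shows "(z, x) \<in> (del_edge T x y)\<^sup>* \<longleftrightarrow> (y, z) \<notin> (del_edge T x y)\<^sup>*"
proof -
  let ?R = "del_edge T x y"
  have s: "sym ?R" using sym_edge_ops(1)[OF treesD(2)[OF T]] .
  have nxy: "(x, y) \<notin> ?R\<^sup>*" using treesD(4)[OF T xy] .
  have "(z, x) \<in> T\<^sup>*" using treesD(3)[OF T] z x by (auto simp: connects_def)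
  then have "(z, x) \<in> (add_edge ?R x y)\<^sup>*"
    using add_del_edge[OF treesD(2)[OF T] xy] by simp
  then have "(z, x) \<in> ?R\<^sup>* \<or> (z, y) \<in> ?R\<^sup>*"
    using rtrancl_add_edge_cases by metis
  then show ?thesis using nxy s by (meson rtrancl_trans sym_rtranclD)
qed

text \<open>
  The exchange step: cut the tree at \<open>xy\<close> and join the two sides again by an edge \<open>uw\<close> across the cut.
  For another edge \<open>pq\<close> to lose its bridge property, \<open>p\<close> and \<open>q\<close> would have to be joined through \<open>uw\<close>,
  hence lie on different sides of the cut; but they are adjacent.
\<close>

lemma tree_exchange:
  assumes T: "T \<in> trees V E1" and xy: "(x, y) \<in> T" and V: "x \<in> V"
    and xu: "(x, u) \<in> (del_edge T x y)\<^sup>*" and yw: "(y, w) \<in> (del_edge T x y)\<^sup>*"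
    and sub: "add_edge (del_edge T x y) u w \<subseteq> E2"
  shows "add_edge (del_edge T x y) u w \<in> trees V E2"
proof -
  let ?R = "del_edge T x y"
  let ?T = "add_edge ?R u w"
  note t = treesD[OF T]
  have s: "sym ?R" using sym_edge_ops(1)[OF t(2)] .
  have sT: "sym ?T" using sym_edge_ops(2)[OF s] .
  have nxy: "(x, y) \<notin> ?R\<^sup>*" using t(4)[OF xy] .
  have nuw: "(u, w) \<notin> ?R\<^sup>*" using nxy xu yw s by (meson rtrancl_trans sym_rtranclD)
  have RT: "?R\<^sup>* \<subseteq> ?T\<^sup>*" by (rule rtrancl_mono) (auto simp: add_edge_def)
  have uw: "(u, w) \<in> ?T\<^sup>*" by (auto simp: add_edge_def)
  have yx: "(y, x) \<in> ?T\<^sup>*"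
    using RT uw xu yw sT by (meson rtrancl_trans subsetD sym_rtranclD)
  have reach: "(z, x) \<in> ?T\<^sup>*" if "z \<in> V" for z
    using tree_sides[OF T xy that V] RT yx sT by (meson rtrancl_trans subsetD sym_rtranclD)
  have "connects V ?T"
    unfolding connects_def using reach sT by (meson rtrancl_trans sym_rtranclD)
  moreover have "is_bridge ?T p q" if pq: "(p, q) \<in> ?T" for p q
  proof (cases "(p, q) = (u, w) \<or> (p, q) = (w, u)")
    case True
    have "(u, w) \<notin> ?R" using nuw by blast
    then have "del_edge ?T u w = ?R" using del_add_edge[OF s] by simp
    then show ?thesis using True nuw is_bridge_commute[OF sT] by (auto simp: is_bridge_def)
  next
    case False
    let ?S = "del_edge ?R p q"
    have pqR: "(p, q) \<in> ?R" using pq False by (auto simp: add_edge_def)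
    have "del_edge ?T p q \<subseteq> add_edge ?S u w" using False
      by (auto simp: add_edge_def del_edge_def)
    then have sub: "(del_edge ?T p q)\<^sup>* \<subseteq> (add_edge ?S u w)\<^sup>*" by (rule rtrancl_mono)
    have SR: "?S\<^sup>* \<subseteq> ?R\<^sup>*" by (rule rtrancl_mono) (auto simp: del_edge_def)
    have ST: "?S\<^sup>* \<subseteq> (del_edge T p q)\<^sup>*" by (rule rtrancl_mono) (auto simp: del_edge_def)
    have "(p, q) \<in> T" using pqR by (auto simp: del_edge_def)
    then have n: "(p, q) \<notin> ?S\<^sup>*" using t(4) ST by blast
    show ?thesis unfolding is_bridge_def
    proof
      assume "(p, q) \<in> (del_edge ?T p q)\<^sup>*"
      then consider "(p, u) \<in> ?S\<^sup>*" "(w, q) \<in> ?S\<^sup>*" | "(p, w) \<in> ?S\<^sup>*" "(u, q) \<in> ?S\<^sup>*"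
        using sub n rtrancl_add_edge_cases[of p q ?S u w] by blast
      moreover have "(p, q) \<in> ?R\<^sup>*" using pqR by blast
      ultimately show False
        using SR nuw s by cases (meson rtrancl_trans subsetD sym_rtranclD)+
    qed
  qed
  ultimately show ?thesis using sT sub by (auto simp: trees_def)
qed

text \<open>
  The path in a tree from \<open>x\<close> to \<open>z\<close> leaves \<open>x\<close> in exactly one direction. Paths are avoided: the
  direction is the neighbour \<open>y\<close> whose branch, the part cut off by the edge \<open>xy\<close>, contains \<open>z\<close>. Both
  existence and uniqueness come from walks that stay away from \<open>x\<close>.
\<close>

lemma tree_first_step:
  assumes T: "T \<in> trees V E" and x: "x \<in> V" and z: "z \<in> V" and xz: "x \<noteq> z"
  shows "\<exists>!y. (x, y) \<in> T \<and> (y, z) \<in> (del_edge T x y)\<^sup>*"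
proof -
  note t = treesD[OF T]
  define S where "S = {e \<in> T. fst e \<noteq> x \<and> snd e \<noteq> x}"
  have sS: "sym S" using t(2) unfolding S_def sym_def by auto
  have Sdel: "S\<^sup>* \<subseteq> (del_edge T x y)\<^sup>*" for y
    by (rule rtrancl_mono) (auto simp: S_def del_edge_def)
  have "(x, z) \<in> T\<^sup>*" using t(3) x z by (auto simp: connects_def)
  \<comment> \<open>either \<open>b\<close> itself or some neighbour of \<open>x\<close> is joined to \<open>z\<close> without touching \<open>x\<close>; for \<open>b = x\<close> only the second is possible\<close>
  moreover have "(b \<noteq> x \<and> (b, z) \<in> S\<^sup>*) \<or> (\<exists>y. (x, y) \<in> T \<and> (y, z) \<in> S\<^sup>*)"
    if "(b, z) \<in> T\<^sup>*" for b
    using that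
  proof (induction rule: converse_rtrancl_induct)
    case base
    then show ?case using xz by simp
  next
    case (step a b)
    show ?case
    proof (cases "\<exists>y. (x, y) \<in> T \<and> (y, z) \<in> S\<^sup>*")
      case False
      with step.IH have b: "b \<noteq> x" "(b, z) \<in> S\<^sup>*" by auto
      then have "a \<noteq> x" using False step.hyps by blast
      then have "(a, b) \<in> S" using b step.hyps by (simp add: S_def)
      then show ?thesis using b \<open>a \<noteq> x\<close> by (meson converse_rtrancl_into_rtrancl)
    qed simp
  qed
  ultimately obtain y where y: "(x, y) \<in> T" "(y, z) \<in> S\<^sup>*" by blast
  have inS: "(y, c) \<in> S\<^sup>*" if "(x, y) \<in> T" "(y, c) \<in> (del_edge T x y)\<^sup>*" for y c
    using that(2)
  proof (induction rule: rtrancl_induct)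
    case (step c d)
    have n: "(y, x) \<notin> (del_edge T x y)\<^sup>*"
      using t(4)[OF that(1)] sym_rtranclD[OF sym_edge_ops(1)[OF t(2)]] by metis
    have "c \<noteq> x" using n step.hyps(1) by auto
    moreover have "d \<noteq> x" using n rtrancl_into_rtrancl[OF step.hyps] by auto
    ultimately have "(c, d) \<in> S" using step.hyps(2) by (auto simp: S_def del_edge_def)
    with step.IH show ?case by (rule rtrancl_into_rtrancl)
  qed simp
  have "y1 = y2"
    if 1: "(x, y1) \<in> T" "(y1, z) \<in> (del_edge T x y1)\<^sup>*"
      and 2: "(x, y2) \<in> T" "(y2, z) \<in> (del_edge T x y2)\<^sup>*" for y1 y2
  proof (rule ccontr)
    assume ne: "y1 \<noteq> y2"
    have "(z, y1) \<in> S\<^sup>*" using inS[OF 1] sS sym_rtranclD by metis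
    then have "(y2, y1) \<in> S\<^sup>*" using inS[OF 2] rtrancl_trans by metis
    then have "(y2, y1) \<in> (del_edge T x y1)\<^sup>*" using Sdel by blast
    moreover have "(x, y2) \<in> del_edge T x y1" using 2 ne by (auto simp: del_edge_def)
    ultimately show False using t(4)[OF 1(1)] converse_rtrancl_into_rtrancl by metis
  qed
  with y Sdel show ?thesis by blast
qed

lemma tree_first_step_count:
  assumes T: "T \<in> trees V E" and x: "x \<in> V" and z: "z \<in> V" and fin: "finite V"
    and EV: "E \<subseteq> V \<times> V"
  shows "(\<Sum>y\<in>V. of_bool ((x, y) \<in> T \<and> (y, z) \<in> (del_edge T x y)\<^sup>*)) = (of_bool (x \<noteq> z) :: real)"
proof (cases "x = z")
  case True
  have "(x, y) \<in> T \<Longrightarrow> (y, x) \<notin> (del_edge T x y)\<^sup>*" for y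
    using treesD(4)[OF T] sym_rtranclD[OF sym_edge_ops(1)[OF treesD(2)[OF T]]] by metis
  then have "(\<Sum>y\<in>V. of_bool ((x, y) \<in> T \<and> (y, z) \<in> (del_edge T x y)\<^sup>*)) = (0::real)"
    using True by (intro sum.neutral) auto
  then show ?thesis using True by simp
next
  case False
  obtain y0 where y0: "\<And>y. ((x, y) \<in> T \<and> (y, z) \<in> (del_edge T x y)\<^sup>*) = (y = y0)"
    using tree_first_step[OF T x z False] by blast
  then have "y0 \<in> V" using treesD(1)[OF T] EV by blast
  then show ?thesis unfolding y0 using False fin by (simp add: of_bool_def sum.delta)
qed

section \<open>The current across a deleted edge\<close>

text \<open>
  Trees through the edge \<open>uw\<close> are recorded as the two-component forests that they become without it.
\<close>

definition split_forests :: "'a set \<Rightarrow> ('a \<times> 'a) set \<Rightarrow> 'a \<Rightarrow> 'a \<Rightarrow> ('a \<times> 'a) set set" where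
  "split_forests V E u w =
     {F. F \<subseteq> del_edge E u w \<and> sym F \<and> add_edge F u w \<in> trees V E}"

lemma split_forest_sides:
  assumes F: "F \<in> split_forests V E u w"
  shows "(u, w) \<notin> F\<^sup>*" "del_edge (add_edge F u w) u w = F" "sym F"
    "u \<in> V \<Longrightarrow> z \<in> V \<Longrightarrow> (u, z) \<notin> F\<^sup>* \<Longrightarrow> (w, z) \<in> F\<^sup>*"
proof -
  have T: "add_edge F u w \<in> trees V E" and s: "sym F" and FE: "F \<subseteq> del_edge E u w"
    using F by (auto simp: split_forests_def)
  have uw: "(u, w) \<in> add_edge F u w" by (simp add: add_edge_def)
  have "(u, w) \<notin> F" using FE by (auto simp: del_edge_def)
  then show d: "del_edge (add_edge F u w) u w = F" using del_add_edge[OF s] by simp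
  show "sym F" by (rule s)
  show "(u, w) \<notin> F\<^sup>*" using treesD(4)[OF T uw] d by simp
  show "(w, z) \<in> F\<^sup>*" if "u \<in> V" "z \<in> V" "(u, z) \<notin> F\<^sup>*"
    using tree_sides[OF T uw that(2,1)] d that(3) sym_rtranclD[OF s] by metis
qed

lemma trees_through_edge:
  assumes s: "sym E" and uw: "(u, w) \<in> E"
  shows "trees V E = trees V (del_edge E u w) \<union> (\<lambda>F. add_edge F u w) ` split_forests V E u w"
    and "trees V (del_edge E u w) \<inter> (\<lambda>F. add_edge F u w) ` split_forests V E u w = {}"
    and "inj_on (\<lambda>F. add_edge F u w) (split_forests V E u w)"
proof -
  show "inj_on (\<lambda>F. add_edge F u w) (split_forests V E u w)"
    by (rule inj_on_inverseI[where g = "\<lambda>T. del_edge T u w"]) (rule split_forest_sides(2))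
  show "trees V (del_edge E u w) \<inter> (\<lambda>F. add_edge F u w) ` split_forests V E u w = {}"
    by (auto dest!: treesD(1) simp: add_edge_def del_edge_def)
  show "trees V E = trees V (del_edge E u w) \<union> (\<lambda>F. add_edge F u w) ` split_forests V E u w"
  proof (intro equalityI subsetI)
    fix T assume T: "T \<in> trees V E"
    note t = treesD[OF T]
    show "T \<in> trees V (del_edge E u w) \<union> (\<lambda>F. add_edge F u w) ` split_forests V E u w"
    proof (cases "(u, w) \<in> T")
      case True
      then have "T = add_edge (del_edge T u w) u w" using add_del_edge[OF t(2)] by simp
      moreover have "del_edge T u w \<in> split_forests V E u w"
        unfolding split_forests_def using calculation[symmetric] T t(1) sym_edge_ops(1)[OF t(2)]
        by (auto simp: del_edge_def)
      ultimately show ?thesis by blast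
    next
      case False
      then have "(w, u) \<notin> T" using t(2) by (meson symD)
      then have "T \<subseteq> del_edge E u w" using False t(1) by (auto simp: del_edge_def)
      then have "T \<in> trees V (del_edge E u w)" using T by (simp add: trees_def)
      then show ?thesis by blast
    qed
  next
    fix T assume "T \<in> trees V (del_edge E u w) \<union> (\<lambda>F. add_edge F u w) ` split_forests V E u w"
    then show "T \<in> trees V E"
    proof
      assume "T \<in> trees V (del_edge E u w)"
      then show ?thesis using del_edge_subset[of E u w] by (auto simp: trees_def)
    qed (auto simp: split_forests_def)
  qed
qed

lemma card_trees_through_edge:
  assumes "finite E" "sym E" "(u, w) \<in> E"
  shows "card (trees V E) = card (trees V (del_edge E u w)) + card (split_forests V E u w)"
    and "finite (split_forests V E u w)"
proof -
  note te = trees_through_edge[OF assms(2,3), of V]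
  have f: "finite (trees V E)" using finite_trees assms by blast
  show f2: "finite (split_forests V E u w)"
    using te f finite_imageD by (metis finite_Un)
  have "card (trees V E) = card (trees V (del_edge E u w)) + card ((\<lambda>F. add_edge F u w) ` split_forests V E u w)"
    using te f by (metis card_Un_disjoint finite_Un)
  then show "card (trees V E) = card (trees V (del_edge E u w)) + card (split_forests V E u w)"
    using card_image[OF te(3)] by simp
qed

text \<open>
  Trees whose path from \<open>u\<close> to \<open>w\<close> runs through the arc \<open>(x, y)\<close> correspond, by exchanging \<open>xy\<close> for
  \<open>uw\<close>, to the two-component forests with \<open>x\<close> on the side of \<open>u\<close> and \<open>y\<close> on the side of \<open>w\<close>. This is what
  makes the averaged path flow a gradient.
\<close>

lemma card_path_trees:
  assumes s: "sym E" and EV: "E \<subseteq> V \<times> V" and uw: "(u, w) \<in> E"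
    and xy: "(x, y) \<in> del_edge E u w"
  shows "card {T \<in> trees V (del_edge E u w). (x, y) \<in> T \<and>
             (u, x) \<in> (del_edge T x y)\<^sup>* \<and> (y, w) \<in> (del_edge T x y)\<^sup>*}
       = card {F \<in> split_forests V E u w. (u, x) \<in> F\<^sup>* \<and> (u, y) \<notin> F\<^sup>*}" (is "card ?A = card ?B")
proof (rule bij_betw_same_card)
  have V: "x \<in> V" "y \<in> V" "u \<in> V" "w \<in> V" using EV xy uw by (auto simp: del_edge_def)
  show "bij_betw (\<lambda>T. del_edge T x y) ?A ?B"
  proof (rule bij_betw_byWitness[where f' = "\<lambda>F. add_edge F x y"])
    show "\<forall>T\<in>?A. add_edge (del_edge T x y) x y = T"
      by (auto intro!: add_del_edge dest: treesD(2))
    show "\<forall>F\<in>?B. del_edge (add_edge F x y) x y = F"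
    proof
      fix F assume F: "F \<in> ?B"
      then have "(x, y) \<notin> F" by (auto dest: rtrancl_into_rtrancl)
      moreover have "sym F" using F split_forest_sides(3)[of F V E u w] by simp
      ultimately show "del_edge (add_edge F x y) x y = F" by (rule del_add_edge[rotated])
    qed
    show "(\<lambda>T. del_edge T x y) ` ?A \<subseteq> ?B"
    proof
      fix F assume "F \<in> (\<lambda>T. del_edge T x y) ` ?A"
      then obtain T where F: "F = del_edge T x y" and T: "T \<in> trees V (del_edge E u w)"
        and xyT: "(x, y) \<in> T" and ux: "(u, x) \<in> F\<^sup>*" and yw: "(y, w) \<in> F\<^sup>*" by blast
      have sF: "sym F" unfolding F using sym_edge_ops(1)[OF treesD(2)[OF T]] .
      have FE: "F \<subseteq> del_edge E u w" unfolding F using subset_trans[OF del_edge_subset treesD(1)[OF T]] .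
      have "add_edge F u w \<subseteq> E"
        using FE uw symD[OF s uw] del_edge_subset[of E u w] unfolding add_edge_def by blast
      then have "add_edge F u w \<in> trees V E"
        using tree_exchange[OF T xyT V(1), of u w E, folded F] sym_rtranclD[OF sF ux] yw
        by blast
      moreover have "(u, y) \<notin> F\<^sup>*"
        using treesD(4)[OF T xyT, folded F] rtrancl_trans[OF sym_rtranclD[OF sF ux]] by blast
      ultimately show "F \<in> ?B" using sF FE ux by (simp add: split_forests_def)
    qed
    show "(\<lambda>F. add_edge F x y) ` ?B \<subseteq> ?A"
    proof
      fix T assume "T \<in> (\<lambda>F. add_edge F x y) ` ?B"
      then obtain F where T: "T = add_edge F x y" and F: "F \<in> split_forests V E u w"
        and ux: "(u, x) \<in> F\<^sup>*" and uy: "(u, y) \<notin> F\<^sup>*" by blast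
      note f = split_forest_sides[OF F]
      have wy: "(w, y) \<in> F\<^sup>*" using f(4) V uy by blast
      have FT: "add_edge F u w \<in> trees V E" and FE: "F \<subseteq> del_edge E u w"
        using F by (auto simp: split_forests_def)
      have "(y, x) \<in> del_edge E u w" using symD[OF sym_edge_ops(1)[OF s] xy] .
      then have sub: "add_edge F x y \<subseteq> del_edge E u w"
        using FE xy by (auto simp: add_edge_def)
      have "(u, w) \<in> add_edge F u w" by (simp add: add_edge_def)
      from tree_exchange[OF FT this V(3), of x y "del_edge E u w"]
      have "T \<in> trees V (del_edge E u w)" unfolding f(2) T using ux wy sub by simp
      moreover have "(x, y) \<notin> F" using rtrancl_into_rtrancl[OF ux] uy by blast
      then have "del_edge T x y = F" unfolding T using del_add_edge[OF f(3)] by simp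
      ultimately show "T \<in> ?A" using ux sym_rtranclD[OF f(3) wy] T
        by (simp add: add_edge_def)
    qed
  qed
qed

text \<open>
  For one tree, the unit flow along the path from \<open>u\<close> to \<open>w\<close> has a source at \<open>u\<close> and a sink at \<open>w\<close>. On
  the arc \<open>(x, y)\<close> it is the indicator that \<open>w\<close> lies in the branch of \<open>y\<close> minus the indicator that \<open>u\<close>
  does, and exactly one branch at \<open>x\<close> contains a given vertex other than \<open>x\<close>.
\<close>

lemma current_conservation:
  assumes fin: "finite V" and EV: "E \<subseteq> V \<times> V" and u: "u \<in> V" and w: "w \<in> V" and x: "x \<in> V"
    and T: "T \<in> trees V E"
  shows "(\<Sum>y\<in>V. of_bool ((x, y) \<in> T \<and> (u, x) \<in> (del_edge T x y)\<^sup>* \<and> (y, w) \<in> (del_edge T x y)\<^sup>*)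
              - of_bool ((y, x) \<in> T \<and> (u, y) \<in> (del_edge T y x)\<^sup>* \<and> (x, w) \<in> (del_edge T y x)\<^sup>*))
       = (of_bool (x \<noteq> w) - of_bool (x \<noteq> u) :: real)" (is "?L = _")
proof -
  note t = treesD[OF T]
  have "?L = (\<Sum>y\<in>V. of_bool ((x, y) \<in> T \<and> (y, w) \<in> (del_edge T x y)\<^sup>*)
                    - of_bool ((x, y) \<in> T \<and> (y, u) \<in> (del_edge T x y)\<^sup>*))"
  proof (rule sum.cong[OF refl], cases)
    fix y assume "y \<in> V" and xy: "(x, y) \<in> T"
    let ?R = "del_edge T x y"
    have s: "sym ?R" using sym_edge_ops(1)[OF t(2)] .
    have yx: "(y, x) \<in> T" using symD[OF t(2) xy] .
    have sw: "(a, b) \<in> ?R\<^sup>* \<longleftrightarrow> (b, a) \<in> ?R\<^sup>*" for a b using sym_rtranclD[OF s] by blast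
    have 1: "(u, x) \<in> ?R\<^sup>* \<longleftrightarrow> (y, u) \<notin> ?R\<^sup>*" by (rule tree_sides[OF T xy u x])
    have 2: "(x, w) \<in> ?R\<^sup>* \<longleftrightarrow> (y, w) \<notin> ?R\<^sup>*" using tree_sides[OF T xy w x] sw by blast
    have 3: "(u, y) \<in> ?R\<^sup>* \<longleftrightarrow> (y, u) \<in> ?R\<^sup>*" by (rule sw)
    show "of_bool ((x, y) \<in> T \<and> (u, x) \<in> (del_edge T x y)\<^sup>* \<and> (y, w) \<in> (del_edge T x y)\<^sup>*)
              - of_bool ((y, x) \<in> T \<and> (u, y) \<in> (del_edge T y x)\<^sup>* \<and> (x, w) \<in> (del_edge T y x)\<^sup>*)
        = (of_bool ((x, y) \<in> T \<and> (y, w) \<in> (del_edge T x y)\<^sup>*)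
              - of_bool ((x, y) \<in> T \<and> (y, u) \<in> (del_edge T x y)\<^sup>*) :: real)"
      unfolding del_edge_commute[of T y x] 1 2 3 using xy yx by auto
  next
    fix y assume "y \<in> V" and xy: "(x, y) \<notin> T"
    then have "(y, x) \<notin> T" using symD[OF t(2)] by blast
    then show "of_bool ((x, y) \<in> T \<and> (u, x) \<in> (del_edge T x y)\<^sup>* \<and> (y, w) \<in> (del_edge T x y)\<^sup>*)
              - of_bool ((y, x) \<in> T \<and> (u, y) \<in> (del_edge T y x)\<^sup>* \<and> (x, w) \<in> (del_edge T y x)\<^sup>*)
        = (of_bool ((x, y) \<in> T \<and> (y, w) \<in> (del_edge T x y)\<^sup>*)
              - of_bool ((x, y) \<in> T \<and> (y, u) \<in> (del_edge T x y)\<^sup>*) :: real)"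
      using xy by simp
  qed
  also have "\<dots> = of_bool (x \<noteq> w) - of_bool (x \<noteq> u)"
    unfolding sum_subtractf tree_first_step_count[OF T x w fin EV] tree_first_step_count[OF T x u fin EV] ..
  finally show ?thesis .
qed

text \<open>
  Kirchhoff's description of the current from \<open>u\<close> to \<open>w\<close> in \<open>E\<close> without \<open>uw\<close>: it is the average, over all
  spanning trees, of the unit flow along the tree path from \<open>u\<close> to \<open>w\<close>. By the exchange bijection
  it is also the gradient of the potential \<open>\<phi> x\<close> that counts the two-component forests with \<open>x\<close> on the
  side of \<open>u\<close>. A unit flow that is a gradient has energy equal to its potential drop, here the number of
  forests divided by the number of trees; returning the current through \<open>uw\<close> adds one, and the
  sum is the ratio of the two tree counts. Every edge appears as two arcs in the sums, whence the
  factor 2. Bridges carry no current since their ends are on the same side in every forest.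
\<close>

lemma deletion_flow:
  fixes V :: "'a set" and u w :: 'a
  assumes fin: "finite V" and EV: "E \<subseteq> V \<times> V" and s: "sym E"
    and uw: "(u, w) \<in> E" "u \<noteq> w" and conn: "connects V (del_edge E u w)"
  obtains \<theta> :: "'a \<Rightarrow> 'a \<Rightarrow> real" where
    "\<And>x y. \<theta> x y = - \<theta> y x"
    "\<And>x y. (x, y) \<notin> E \<Longrightarrow> \<theta> x y = 0"
    "\<And>x y. is_bridge E x y \<Longrightarrow> \<theta> x y = 0"
    "\<theta> u w = 1"
    "\<And>x. x \<in> V \<Longrightarrow> (\<Sum>y\<in>V. \<theta> x y) = 0"
    "(\<Sum>x\<in>V. \<Sum>y\<in>V. (\<theta> x y)\<^sup>2) * card (trees V (del_edge E u w)) = 2 * card (trees V E)"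
proof -
  define H where "H = del_edge E u w"
  define P where "P = split_forests V E u w"
  define \<kappa> where "\<kappa> = real (card (trees V H))"
  define \<phi> where "\<phi> = (\<lambda>x. real (card {F \<in> P. (u, x) \<in> F\<^sup>*}))"
  define c where "c = (\<lambda>x y. real (card {T \<in> trees V H. (x, y) \<in> T \<and>
             (u, x) \<in> (del_edge T x y)\<^sup>* \<and> (y, w) \<in> (del_edge T x y)\<^sup>*}))"
  define g where "g = (\<lambda>x y. if (x, y) \<in> H then \<phi> x - \<phi> y else 0)"
  have finE: "finite E" using EV fin by (meson finite_SigmaI finite_subset)
  have sH: "sym H" unfolding H_def by (rule sym_edge_ops(1)[OF s])
  have HE: "H \<subseteq> E" unfolding H_def by (rule del_edge_subset)
  have finH: "finite H" using HE finE finite_subset by blast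
  have HV: "H \<subseteq> V \<times> V" using HE EV by blast
  have u: "u \<in> V" and w: "w \<in> V" using EV uw by auto
  have finT: "finite (trees V H)" by (rule finite_trees[OF finH])
  have finP: "finite P" unfolding P_def by (rule card_trees_through_edge(2)[OF finE s uw(1)])
  have cardE: "real (card (trees V E)) = \<kappa> + card P"
    unfolding \<kappa>_def P_def H_def using card_trees_through_edge(1)[OF finE s uw(1)] by simp
  have "trees V H \<noteq> {}" using trees_nonempty[OF finH sH] conn by (simp add: H_def)
  then have \<kappa>0: "\<kappa> > 0" unfolding \<kappa>_def using finT by (simp add: card_gt_0_iff)
  have gs: "g x y = - g y x" for x y unfolding g_def using symD[OF sH] by auto
  \<comment> \<open>the averaged path flow equals the gradient of the potential\<close>
  have cg: "c x y - c y x = g x y" for x y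
  proof (cases "(x, y) \<in> H")
    case True
    have yx: "(y, x) \<in> H" using symD[OF sH True] .
    have c: "c x y = card {F \<in> P. (u, x) \<in> F\<^sup>* \<and> (u, y) \<notin> F\<^sup>*}" if "(x, y) \<in> H" for x y
      unfolding c_def P_def H_def using card_path_trees[OF s EV uw(1)] that by (simp add: H_def)
    have split: "\<phi> x = real (card {F \<in> P. (u, x) \<in> F\<^sup>* \<and> (u, y) \<notin> F\<^sup>*})
          + card {F \<in> P. (u, x) \<in> F\<^sup>* \<and> (u, y) \<in> F\<^sup>*}" for x y
    proof -
      have "{F \<in> P. (u, x) \<in> F\<^sup>*} = {F \<in> P. (u, x) \<in> F\<^sup>* \<and> (u, y) \<notin> F\<^sup>*}
          \<union> {F \<in> P. (u, x) \<in> F\<^sup>* \<and> (u, y) \<in> F\<^sup>*}" by blast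
      then show ?thesis unfolding \<phi>_def using finP
        by (subst card_Un_disjoint[symmetric, THEN arg_cong[of _ _ real], unfolded of_nat_add]) auto
    qed
    have "{F \<in> P. (u, x) \<in> F\<^sup>* \<and> (u, y) \<in> F\<^sup>*} = {F \<in> P. (u, y) \<in> F\<^sup>* \<and> (u, x) \<in> F\<^sup>*}" by blast
    then show ?thesis unfolding c[OF True] c[OF yx] g_def using True split[of x y] split[of y x] by simp
  next
    case False
    then have "(y, x) \<notin> H" using symD[OF sH] by blast
    then have "(x, y) \<notin> T \<and> (y, x) \<notin> T" if "T \<in> trees V H" for T
      using treesD(1)[OF that] False by blast
    then have "c x y = 0" "c y x = 0" unfolding c_def by (auto simp: card_eq_0_iff)
    with False show ?thesis by (simp add: g_def)
  qed
  have div: "(\<Sum>y\<in>V. g x y) = \<kappa> * (of_bool (x = u) - of_bool (x = w))" if x: "x \<in> V" for x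
  proof -
    have cs: "c x y = (\<Sum>T\<in>trees V H. of_bool ((x, y) \<in> T \<and>
             (u, x) \<in> (del_edge T x y)\<^sup>* \<and> (y, w) \<in> (del_edge T x y)\<^sup>*))" for x y
      unfolding c_def using finT by (simp add: sum_of_bool_eq Int_def)
    have "(\<Sum>y\<in>V. g x y) = (\<Sum>y\<in>V. c x y - c y x)" by (simp add: cg)
    also have "\<dots> = (\<Sum>T\<in>trees V H. \<Sum>y\<in>V.
         of_bool ((x, y) \<in> T \<and> (u, x) \<in> (del_edge T x y)\<^sup>* \<and> (y, w) \<in> (del_edge T x y)\<^sup>*)
       - of_bool ((y, x) \<in> T \<and> (u, y) \<in> (del_edge T y x)\<^sup>* \<and> (x, w) \<in> (del_edge T y x)\<^sup>*))"
      unfolding cs sum_subtractf[symmetric] by (rule sum.swap)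
    also have "\<dots> = (\<Sum>T\<in>trees V H. of_bool (x \<noteq> w) - of_bool (x \<noteq> u))"
      by (rule sum.cong[OF refl]) (rule current_conservation[OF fin HV u w x])
    also have "\<dots> = \<kappa> * (of_bool (x = u) - of_bool (x = w))" by (simp add: \<kappa>_def)
    finally show ?thesis .
  qed
  have Pu: "\<phi> u = card P" by (simp add: \<phi>_def)
  have Pw: "\<phi> w = 0"
    unfolding \<phi>_def using split_forest_sides(1)[of _ V E u w]
    by (auto simp: P_def card_eq_0_iff)
  \<comment> \<open>Ohm's law and conservation turn the energy into the potential difference of \<open>u\<close> and \<open>w\<close>\<close>
  have "(\<Sum>x\<in>V. \<Sum>y\<in>V. (g x y)\<^sup>2) = (\<Sum>x\<in>V. \<Sum>y\<in>V. \<phi> x * g x y - \<phi> y * g x y)"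
    by (intro sum.cong refl) (simp add: g_def power2_eq_square algebra_simps)
  also have "\<dots> = (\<Sum>x\<in>V. \<Sum>y\<in>V. \<phi> x * g x y) - (\<Sum>x\<in>V. \<Sum>y\<in>V. \<phi> y * g x y)"
    by (simp add: sum_subtractf)
  also have "(\<Sum>x\<in>V. \<Sum>y\<in>V. \<phi> y * g x y) = (\<Sum>y\<in>V. \<Sum>x\<in>V. \<phi> y * g x y)" by (rule sum.swap)
  also have "\<dots> = - (\<Sum>y\<in>V. \<Sum>x\<in>V. \<phi> y * g y x)"
    by (subst gs) (simp add: sum_negf)
  also have "(\<Sum>x\<in>V. \<Sum>y\<in>V. \<phi> x * g x y) - - (\<Sum>y\<in>V. \<Sum>x\<in>V. \<phi> y * g y x)
      = 2 * (\<Sum>x\<in>V. \<Sum>y\<in>V. \<phi> x * g x y)" by simp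
  also have "(\<Sum>x\<in>V. \<Sum>y\<in>V. \<phi> x * g x y) = (\<Sum>x\<in>V. \<phi> x * (\<kappa> * (of_bool (x = u) - of_bool (x = w))))"
    unfolding sum_distrib_left[symmetric] by (intro sum.cong refl) (simp add: div)
  also have "\<dots> = (\<Sum>x\<in>V. \<phi> x * \<kappa> * of_bool (x = u)) - (\<Sum>x\<in>V. \<phi> x * \<kappa> * of_bool (x = w))"
    by (simp add: sum_subtractf algebra_simps)
  also have "\<dots> = card P * \<kappa>"
    using fin u w Pu Pw by (simp add: of_bool_def sum.delta if_distrib cong: if_cong)
  finally have energy: "(\<Sum>x\<in>V. \<Sum>y\<in>V. (g x y)\<^sup>2) = 2 * (card P * \<kappa>)" .
  \<comment> \<open>the current returns from \<open>w\<close> to \<open>u\<close>; reversing all signs makes it run from \<open>u\<close> to \<open>w\<close> on the deleted edge\<close>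
  define e where "e = (\<lambda>x y. (of_bool (x = u \<and> y = w) - of_bool (x = w \<and> y = u) :: real))"
  define \<theta> where "\<theta> = (\<lambda>x y. e x y - g x y / \<kappa>)"
  have uwH: "(u, w) \<notin> H" "(w, u) \<notin> H" by (auto simp: H_def del_edge_def)
  have eg: "e x y * g x y = 0" for x y unfolding e_def g_def using uwH by auto
  show thesis
  proof
    fix x y
    have "e x y = - e y x" by (simp add: e_def conj_commute)
    with gs[of x y] show "\<theta> x y = - \<theta> y x" by (simp add: \<theta>_def)
  next
    fix x y assume "(x, y) \<notin> E"
    then have "(x, y) \<notin> H" "\<not> (x = u \<and> y = w)" "\<not> (x = w \<and> y = u)"
      using HE uw(1) symD[OF s uw(1)] by blast+
    then show "\<theta> x y = 0" unfolding \<theta>_def e_def g_def by (simp only: if_False of_bool_eq(1) diff_self div_0)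
  next
    fix x y assume br: "is_bridge E x y"
    have nuw: "(u, w) \<in> H\<^sup>*" using conn u w by (simp add: H_def connects_def)
    moreover have "(w, u) \<in> H\<^sup>*" by (rule sym_rtranclD[OF sH nuw])
    ultimately have "\<not> is_bridge E u w" "\<not> is_bridge E w u"
      by (simp_all only: is_bridge_def H_def del_edge_commute[of E w u] not_not)
    with br have ne: "(x, y) \<noteq> (u, w)" "(x, y) \<noteq> (w, u)" by blast+
    have "\<phi> x = \<phi> y" if xy: "(x, y) \<in> H"
    proof -
      have "(u, x) \<in> F\<^sup>* \<longleftrightarrow> (u, y) \<in> F\<^sup>*" if F: "F \<in> P" for F
      proof -
        let ?T = "add_edge F u w"
        have T: "?T \<in> trees V E" using F by (simp add: P_def split_forests_def)
        note t = treesD[OF T]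
        have "(x, y) \<in> ?T"
        proof (rule ccontr)
          assume n: "(x, y) \<notin> ?T"
          then have "(y, x) \<notin> ?T" using symD[OF t(2)] by blast
          with n t(1) have "?T \<subseteq> del_edge E x y" by (auto simp: del_edge_def)
          moreover have "(x, y) \<in> ?T\<^sup>*" using t(3) xy HV by (auto simp: connects_def)
          ultimately have "(x, y) \<in> (del_edge E x y)\<^sup>*" by (rule subsetD[OF rtrancl_mono])
          then show False using br by (simp add: is_bridge_def)
        qed
        then have xyF: "(x, y) \<in> F" using ne by (auto simp: add_edge_def)
        have "(y, x) \<in> F" using symD[OF split_forest_sides(3) xyF] F by (simp add: P_def)
        show ?thesis
          using rtrancl_into_rtrancl[OF _ xyF] rtrancl_into_rtrancl[OF _ \<open>(y, x) \<in> F\<close>] by (rule iffI)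
      qed
      then have "{F \<in> P. (u, x) \<in> F\<^sup>*} = {F \<in> P. (u, y) \<in> F\<^sup>*}" by blast
      then show ?thesis by (simp add: \<phi>_def)
    qed
    then show "\<theta> x y = 0" using ne by (auto simp: \<theta>_def e_def g_def)
  next
    show "\<theta> u w = 1" using uwH uw(2) by (simp add: \<theta>_def e_def g_def)
  next
    fix x assume x: "x \<in> V"
    have "(\<Sum>y\<in>V. e x y) = of_bool (x = u) - of_bool (x = w)"
      using fin u w by (cases "x = u"; cases "x = w")
        (simp_all add: e_def of_bool_def sum_subtractf sum_negf sum.delta)
    then show "(\<Sum>y\<in>V. \<theta> x y) = 0"
      unfolding \<theta>_def sum_subtractf sum_divide_distrib[symmetric] div[OF x] using \<kappa>0 by simp
  next
    have "(\<Sum>x\<in>V. \<Sum>y\<in>V. (e x y)\<^sup>2) = (\<Sum>x\<in>V. \<Sum>y\<in>V. of_bool (x = u \<and> y = w) + of_bool (x = w \<and> y = u))"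
      using uw(2) by (intro sum.cong refl) (auto simp: e_def)
    also have "\<dots> = (\<Sum>x\<in>V. of_bool (x = u) + of_bool (x = w))"
      using fin u w by (intro sum.cong refl)
        (auto simp: of_bool_def sum.distrib sum.delta)
    also have "\<dots> = 2" using fin u w by (simp add: of_bool_def sum.distrib sum.delta)
    finally have e2: "(\<Sum>x\<in>V. \<Sum>y\<in>V. (e x y)\<^sup>2) = 2" .
    have "(\<theta> x y)\<^sup>2 = (e x y)\<^sup>2 + (g x y)\<^sup>2 / \<kappa>\<^sup>2" for x y
      using eg[of x y] by (simp add: \<theta>_def power2_diff power_divide)
    then have "(\<Sum>x\<in>V. \<Sum>y\<in>V. (\<theta> x y)\<^sup>2) = 2 + 2 * (card P * \<kappa>) / \<kappa>\<^sup>2"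
      by (simp add: sum.distrib e2 energy sum_divide_distrib[symmetric])
    then show "(\<Sum>x\<in>V. \<Sum>y\<in>V. (\<theta> x y)\<^sup>2) * card (trees V (del_edge E u w)) = 2 * card (trees V E)"
      unfolding \<kappa>_def[unfolded H_def, symmetric] using \<kappa>0 cardE
      by (simp add: field_simps power2_eq_square)
  qed
qed

section \<open>An integral for Catalan's constant\<close>

text \<open>
  The error of the truncated series is compared through its derivative: the truncated geometric
  series for \<open>1 / (1 + x\<^sup>2)\<close> is off by at most \<open>x ^ (2 * n)\<close>.
\<close>

lemma arctan_partial_sum_bound:
  fixes a :: real
  assumes "0 \<le> a"
  shows "\<bar>arctan a - (\<Sum>k<n. (- 1) ^ k * a ^ (2 * k + 1) / (2 * k + 1))\<bar> \<le> a ^ (2 * n + 1) / (2 * n + 1)"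
proof -
  define S where "S = (\<lambda>x::real. \<Sum>k<n. (- 1) ^ k * x ^ (2 * k + 1) / (2 * k + 1))"
  define S' where "S' = (\<lambda>x::real. \<Sum>k<n. (- 1) ^ k * x ^ (2 * k))"
  have dS: "(S has_real_derivative S' x) (at x)" for x
    unfolding S_def S'_def
  proof (rule DERIV_sum)
    fix k
    have "((\<lambda>x. (- 1) ^ k * x ^ (2 * k + 1) / real (2 * k + 1)) has_real_derivative
            (- 1) ^ k * (real (2 * k + 1) * x ^ (2 * k)) / real (2 * k + 1)) (at x)"
      by (intro DERIV_cdivide DERIV_cmult) (use DERIV_pow[of "2 * k + 1" x] in simp)
    moreover have "(- 1) ^ k * (real (2 * k + 1) * x ^ (2 * k)) / real (2 * k + 1) = (- 1) ^ k * x ^ (2 * k)"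
      by (simp add: field_simps del: of_nat_add of_nat_mult of_nat_Suc)
    ultimately show "((\<lambda>x. (- 1) ^ k * x ^ (2 * k + 1) / real (2 * k + 1)) has_real_derivative
            (- 1) ^ k * x ^ (2 * k)) (at x)" by (simp only:)
  qed
  have geo: "inverse (1 + x\<^sup>2) - S' x = (- 1) ^ n * x ^ (2 * n) / (1 + x\<^sup>2)" for x :: real
  proof -
    have pos: "1 + x\<^sup>2 > 0" by (simp add: add_pos_nonneg)
    have "S' x = (\<Sum>k<n. (- x\<^sup>2) ^ k)"
      unfolding S'_def by (intro sum.cong refl) (simp add: power_mult power_minus[of "x\<^sup>2"])
    also have "\<dots> = ((- x\<^sup>2) ^ n - 1) / ((- x\<^sup>2) - 1)"
      using pos by (intro geometric_sum) auto
    also have "(- x\<^sup>2) ^ n = (- 1) ^ n * x ^ (2 * n)" by (simp add: power_mult power_minus[of "x\<^sup>2"])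
    finally show ?thesis using pos by (simp add: field_simps)
  qed
  have "\<sigma> * (arctan a - S a) \<le> a ^ (2 * n + 1) / (2 * n + 1)" if \<sigma>: "\<bar>\<sigma>\<bar> = 1" for \<sigma> :: real
  proof -
    define f where "f = (\<lambda>x. x ^ (2 * n + 1) / (2 * n + 1) - \<sigma> * (arctan x - S x))"
    have df: "(f has_real_derivative (x ^ (2 * n) - \<sigma> * (inverse (1 + x\<^sup>2) - S' x))) (at x)" for x
    proof -
      have "((\<lambda>x. x ^ (2 * n + 1) / real (2 * n + 1)) has_real_derivative
            (real (2 * n + 1) * x ^ (2 * n)) / real (2 * n + 1)) (at x)"
        by (intro DERIV_cdivide) (use DERIV_pow[of "2 * n + 1" x] in simp)
      moreover have "(real (2 * n + 1) * x ^ (2 * n)) / real (2 * n + 1) = x ^ (2 * n)"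
        by (simp add: field_simps del: of_nat_add of_nat_mult of_nat_Suc)
      ultimately have "((\<lambda>x. x ^ (2 * n + 1) / real (2 * n + 1)) has_real_derivative x ^ (2 * n)) (at x)"
        by (simp only:)
      then show ?thesis unfolding f_def
        by (intro DERIV_diff DERIV_cmult DERIV_arctan dS)
    qed
    have "f 0 \<le> f a"
    proof (rule DERIV_nonneg_imp_nondecreasing[OF assms])
      fix x :: real
      have "\<bar>\<sigma> * (inverse (1 + x\<^sup>2) - S' x)\<bar> = x ^ (2 * n) / (1 + x\<^sup>2)"
        unfolding geo using \<sigma> by (simp add: abs_mult power_abs power_mult)
      also have "\<dots> \<le> x ^ (2 * n)"
        by (simp add: divide_le_eq power_mult add_pos_nonneg mult_le_cancel_left1)
      finally show "\<exists>y. (f has_real_derivative y) (at x) \<and> 0 \<le> y" using df by force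
    qed
    moreover have "f 0 = 0" unfolding f_def S_def by simp
    ultimately show ?thesis unfolding f_def by linarith
  qed
  from this[of 1] this[of "-1"] show ?thesis by (simp add: S_def)
qed

text \<open>
  With \<open>u = cos (s / 2)\<close> this is the integral of \<open>4 / sqrt (1 + a\<^sup>2 - a\<^sup>2 * u\<^sup>2)\<close> over \<open>{-1..1}\<close>,
  and the integrand is the derivative of a rescaled arcsine.
\<close>

lemma integral_catalan_derivative:
  fixes a :: real
  assumes "a > 0"
  shows "integral {0..2 * pi} (\<lambda>s. 2 * sin (s / 2) / sqrt (1 + (a * sin (s / 2))\<^sup>2)) = 8 * (arctan a / a)"
proof -
  define F where "F = (\<lambda>s. - 4 / a * arcsin (a * cos (s / 2) / sqrt (1 + a\<^sup>2)))"
  have pos: "1 + a\<^sup>2 > 0" by (simp add: add_pos_nonneg)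
  have "((\<lambda>s. 2 * sin (s / 2) / sqrt (1 + (a * sin (s / 2))\<^sup>2)) has_integral (F (2 * pi) - F 0)) {0..2 * pi}"
  proof (rule fundamental_theorem_of_calculus)
    fix s :: real
    define z where "z = a * cos (s / 2) / sqrt (1 + a\<^sup>2)"
    have z2: "1 - z\<^sup>2 = (1 + (a * sin (s / 2))\<^sup>2) / (1 + a\<^sup>2)"
      using pos by (simp add: z_def power_divide power_mult_distrib sin_squared_eq field_simps)
    have "1 - z\<^sup>2 > 0" unfolding z2 using pos by (simp add: add_pos_nonneg)
    then have z1: "-1 < z" "z < 1" using abs_square_less_1[of z] by auto
    have "((\<lambda>s. a * cos (s / 2) / sqrt (1 + a\<^sup>2)) has_real_derivative
        (a * (- sin (s / 2) * (1 / 2)) / sqrt (1 + a\<^sup>2))) (at s)"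
      by (intro DERIV_cdivide DERIV_cmult) (auto intro!: derivative_eq_intros)
    from DERIV_cmult[OF DERIV_chain'[OF this DERIV_arcsin[OF z1, unfolded z_def]], of "- 4 / a"]
    have "(F has_real_derivative
      - 4 / a * (inverse (sqrt (1 - z\<^sup>2)) * (a * (- sin (s / 2) * (1 / 2)) / sqrt (1 + a\<^sup>2)))) (at s)"
      unfolding F_def z_def .
    moreover have "- 4 / a * (inverse (sqrt (1 - z\<^sup>2)) * (a * (- sin (s / 2) * (1 / 2)) / sqrt (1 + a\<^sup>2)))
       = 2 * sin (s / 2) / sqrt (1 + (a * sin (s / 2))\<^sup>2)"
    proof -
      define r where "r = sqrt (1 + a\<^sup>2)"
      define q where "q = sqrt (1 + (a * sin (s / 2))\<^sup>2)"
      have "r > 0" "q > 0" using pos by (simp_all add: r_def q_def add_pos_nonneg)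
      then show ?thesis
        unfolding z2 real_sqrt_divide r_def[symmetric] q_def[symmetric] using assms
        by (simp add: field_simps)
    qed
    ultimately show "(F has_vector_derivative 2 * sin (s / 2) / sqrt (1 + (a * sin (s / 2))\<^sup>2)) (at s within {0..2 * pi})"
      by (simp add: has_real_derivative_iff_has_vector_derivative has_vector_derivative_at_within)
  qed simp
  moreover have "arcsin (a / sqrt (1 + a\<^sup>2)) = arctan a" "arcsin (- (a / sqrt (1 + a\<^sup>2))) = - arctan a"
    using arcsin_sin[of "arctan a"] arcsin_sin[of "- arctan a"] arctan_lbound[of a] arctan_ubound[of a]
    by (simp_all add: sin_arctan)
  then have "F (2 * pi) - F 0 = 8 * (arctan a / a)"
    by (simp add: F_def)
  ultimately show ?thesis by (simp add: integral_unique)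
qed

text \<open>
  Differentiate under the integral in a parameter \<open>a\<close> in front of the sine. The derivative is
  \<open>8 * arctan a / a\<close>. Its power series is 8 times the derivative of the sum of
  \<open>(- 1) ^ k * a ^ (2 * k + 1) / (2 * k + 1)\<^sup>2\<close>, which is Catalan's constant at \<open>a = 1\<close>; the mean value
  theorem on \<open>{0..1}\<close> bounds the difference of the integral and a partial sum.
\<close>

lemma integral_arsinh_sin:
  "integral {0..2 * pi} (\<lambda>s. 2 * arsinh (sin (s / 2))) = 8 * catalan_const"
proof -
  define J where "J = (\<lambda>a::real. integral {0..2 * pi} (\<lambda>s. 2 * arsinh (a * sin (s / 2))))"
  define J' where "J' = (\<lambda>a::real. integral {0..2 * pi} (\<lambda>s. 2 * sin (s / 2) / sqrt (1 + (a * sin (s / 2))\<^sup>2)))"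
  have pos: "1 + x\<^sup>2 > 0" for x :: real by (simp add: add_pos_nonneg)
  have dJ: "(J has_real_derivative J' a) (at a)" for a
    unfolding J_def J'_def
  proof (rule leibniz_rule_field_derivative[where U = UNIV and a = 0 and b = "2 * pi", unfolded cbox_interval])
    fix x s :: real
    have "((\<lambda>x. x * sin (s / 2)) has_real_derivative sin (s / 2)) (at x)"
      by (auto intro!: derivative_eq_intros)
    from DERIV_cmult[OF DERIV_chain'[OF this arsinh_real_has_field_derivative], of 2]
    show "((\<lambda>x. 2 * arsinh (x * sin (s / 2))) has_real_derivative
        2 * sin (s / 2) / sqrt (1 + (x * sin (s / 2))\<^sup>2)) (at x)"
      by (simp add: add.commute)
    show "(\<lambda>s. 2 * arsinh (x * sin (s / 2))) integrable_on {0..2 * pi}"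
      by (intro integrable_continuous_real continuous_intros ballI) simp
    have c: "continuous_on (UNIV \<times> {0..2 * pi}) (\<lambda>p :: real \<times> real. sin (snd p / 2))"
      by (intro continuous_intros) simp
    show "continuous_on (UNIV \<times> {0..2 * pi}) (\<lambda>(x, s). 2 * sin (s / 2) / sqrt (1 + (x * sin (s / 2))\<^sup>2))"
      unfolding case_prod_unfold
    proof (intro continuous_on_divide continuous_on_mult continuous_on_const c continuous_on_real_sqrt
        continuous_on_add continuous_on_power continuous_on_fst continuous_on_id ballI)
      fix p :: "real \<times> real"
      show "sqrt (1 + (fst p * sin (snd p / 2))\<^sup>2) \<noteq> 0" using pos[of "fst p * sin (snd p / 2)"] by simp
    qed
  qed auto
  have J0: "J 0 = 0" by (simp add: J_def)
  have bound: "\<bar>J 1 / 8 - (\<Sum>k<n. (- 1) ^ k / (2 * real k + 1)\<^sup>2)\<bar> \<le> 1 / (2 * real n + 1)" for n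
  proof -
    define D where "D = (\<lambda>x. J x / 8 - (\<Sum>k<n. (- 1) ^ k * x ^ (2 * k + 1) / (2 * real k + 1)\<^sup>2))"
    define D' where "D' = (\<lambda>x. J' x / 8 - (\<Sum>k<n. (- 1) ^ k * x ^ (2 * k) / (2 * real k + 1)))"
    have dD: "(D has_real_derivative D' x) (at x)" for x
      unfolding D_def D'_def
    proof (intro DERIV_diff DERIV_cdivide dJ DERIV_sum)
      fix k
      have "((\<lambda>x. (- 1) ^ k * x ^ (2 * k + 1) / (2 * real k + 1)\<^sup>2) has_real_derivative
            (- 1) ^ k * (real (2 * k + 1) * x ^ (2 * k)) / (2 * real k + 1)\<^sup>2) (at x)"
        by (intro DERIV_cdivide DERIV_cmult) (use DERIV_pow[of "2 * k + 1" x] in simp)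
      moreover have "real (2 * k + 1) = 2 * real k + 1" by simp
      moreover have "2 * real k + 1 \<noteq> 0" by (metis of_nat_0_neq of_nat_Suc of_nat_mult of_nat_numeral add.commute) 
      ultimately show "((\<lambda>x. (- 1) ^ k * x ^ (2 * k + 1) / (2 * real k + 1)\<^sup>2) has_real_derivative
            (- 1) ^ k * x ^ (2 * k) / (2 * real k + 1)) (at x)"
        by (elim DERIV_cong) (simp add: power2_eq_square add.commute)
    qed
    obtain z where z: "0 < z" "z < 1" "D 1 - D 0 = (1 - 0) * D' z"
      using MVT2[of 0 1 D D'] dD by auto
    have "J' z / 8 = arctan z / z" unfolding J'_def integral_catalan_derivative[OF z(1)] by simp
    then have "D' z * z = arctan z - (\<Sum>k<n. (- 1) ^ k * z ^ (2 * k) / (2 * real k + 1)) * z"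
      using z(1) by (simp add: D'_def left_diff_distrib)
    also have "(\<Sum>k<n. (- 1) ^ k * z ^ (2 * k) / (2 * real k + 1)) * z
        = (\<Sum>k<n. (- 1) ^ k * z ^ (2 * k + 1) / (2 * k + 1))"
      unfolding sum_distrib_right by (intro sum.cong refl) (simp add: mult_ac add.commute)
    finally have "D' z * z = arctan z - (\<Sum>k<n. (- 1) ^ k * z ^ (2 * k + 1) / (2 * k + 1))" .
    then have "\<bar>D' z * z\<bar> \<le> z ^ (2 * n) * z / (2 * n + 1)"
      using arctan_partial_sum_bound[of z n] z(1) by (simp add: mult.commute)
    then have "\<bar>D' z\<bar> * z \<le> z ^ (2 * n) / (2 * n + 1) * z" using z(1) by (simp add: abs_mult)
    then have "\<bar>D' z\<bar> \<le> z ^ (2 * n) / (2 * n + 1)" using z(1) by (rule mult_right_le_imp_le)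
    also have "\<dots> \<le> 1 / (2 * n + 1)" using z by (intro divide_right_mono power_le_one) auto
    finally show ?thesis using z(3) J0 by (simp add: D_def add.commute)
  qed
  have "(\<lambda>n. (\<Sum>k<n. (- 1) ^ k / (2 * real k + 1)\<^sup>2)) \<longlonglongrightarrow> J 1 / 8"
  proof (rule LIM_zero_cancel, rule Lim_null_comparison)
    show "\<forall>\<^sub>F n in sequentially. norm ((\<Sum>k<n. (- 1) ^ k / (2 * real k + 1)\<^sup>2) - J 1 / 8) \<le> 1 / (2 * real n + 1)"
      using bound by (simp add: abs_minus_commute)
    show "(\<lambda>n. 1 / (2 * real n + 1)) \<longlonglongrightarrow> 0" by real_asymp
  qed
  then have "(\<lambda>n. (- 1) ^ n / (2 * real n + 1)\<^sup>2) sums (J 1 / 8)" by (simp add: sums_def)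
  then have "catalan_const = J 1 / 8" unfolding catalan_const_def by (rule sums_unique[symmetric])
  then show ?thesis by (simp add: J_def)
qed

section \<open>The one-dimensional Szego bound\<close>

text \<open>
  Cauchy's integral formula at the centre of the unit circle.
\<close>

lemma circle_mean_value:
  fixes q :: "complex \<Rightarrow> complex"
  assumes "q holomorphic_on UNIV"
  shows "((\<lambda>s. q (cis s)) has_integral (2 * pi * q 0)) {0..2 * pi}"
proof -
  have "((\<lambda>u. q u / (u - 0)) has_contour_integral (2 * of_real pi * \<i> * q 0)) (circlepath 0 1)"
    by (rule Cauchy_integral_circlepath_simple) (use assms holomorphic_on_subset in auto)
  then have "((\<lambda>t. q (cis t) / cis t * \<i> * cis t) has_integral (2 * of_real pi * \<i> * q 0)) {0..2 * pi}"
    unfolding circlepath_def by (subst (asm) has_contour_integral_part_circlepath_iff) auto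
  then have "((\<lambda>t. q (cis t) / cis t * \<i> * cis t * (- \<i>)) has_integral (2 * of_real pi * \<i> * q 0 * (- \<i>))) {0..2 * pi}"
    by (rule has_integral_mult_left)
  moreover have "q (cis t) / cis t * \<i> * cis t * (- \<i>) = q (cis t)" for t
    by (simp add: field_simps)
  moreover have "2 * of_real pi * \<i> * q 0 * (- \<i>) = 2 * pi * q 0"
    by (simp add: field_simps)
  ultimately show ?thesis by (simp only:)
qed

text \<open>
  On the unit circle \<open>cos s\<close> is \<open>(z + 1/z) / 2\<close>. The factor \<open>1/z\<close> is harmless except on the constant
  coefficient, which is treated separately.
\<close>

lemma cos_times_Re_poly:
  fixes q :: "complex poly"
  shows "\<exists>p. \<forall>s. cos s * Re (poly q (cis s)) = Re (poly p (cis s))"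
proof -
  obtain a q' where q: "q = pCons a q'" by (cases q)
  define p where "p = [:0, of_real (Re a):] + smult (1 / 2) ([:0, 0, 1:] * q' + q')"
  have "cos s * Re (poly q (cis s)) = Re (poly p (cis s))" for s
  proof -
    define w where "w = poly q' (cis s)"
    have "Re w * (cos s * cos s) + Re w * (sin s * sin s) = Re w"
      unfolding distrib_left[symmetric] using sin_cos_squared_add2[of s] by (simp add: power2_eq_square)
    then have "2 * (cos s * Re (cis s * w)) = Re (cis s * cis s * w + w)"
      by (simp add: algebra_simps)
    then show ?thesis by (simp add: q p_def w_def[symmetric] field_simps)
  qed
  then show ?thesis by blast
qed

text \<open>
  Weierstrass approximation of \<open>h\<close> on \<open>{-1..1}\<close>; powers of the cosine are real parts of polynomials
  in \<open>cis s\<close>.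
\<close>

lemma trig_poly_approx:
  fixes h :: "real \<Rightarrow> real"
  assumes h: "continuous_on {-1..1} h" and e: "e > 0"
  obtains g :: "complex poly" where "\<And>s. \<bar>h (cos s) - Re (poly g (cis s))\<bar> < e"
proof -
  obtain k where k: "real_polynomial_function k" "\<And>x. x \<in> {-1..1} \<Longrightarrow> \<bar>h x - k x\<bar> < e"
    using Stone_Weierstrass_real_polynomial_function[OF compact_Icc h e] by blast
  obtain a n where kn: "k = (\<lambda>x. \<Sum>i\<le>n. a i * x ^ i)"
    using k(1) unfolding real_polynomial_function_iff_sum by blast
  have "\<exists>p :: complex poly. \<forall>s. cos s ^ i = Re (poly p (cis s))" for i
  proof (induction i)
    case 0
    show ?case by (intro exI[of _ 1]) simp
  next
    case (Suc i)
    then obtain q :: "complex poly" where "\<forall>s. cos s ^ i = Re (poly q (cis s))" by blast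
    with cos_times_Re_poly[of q] show ?case by simp
  qed
  then obtain P :: "nat \<Rightarrow> complex poly" where P: "\<And>i s. cos s ^ i = Re (poly (P i) (cis s))" by metis
  define g where "g = (\<Sum>i\<le>n. smult (of_real (a i)) (P i))"
  have "k (cos s) = Re (poly g (cis s))" for s
    by (simp add: kn g_def P poly_sum Re_sum)
  then show thesis using that[of g] k(2)[of "cos s" for s] by simp
qed

text \<open>
  Up to a factor \<open>exp e\<close>, the weight is the absolute value of \<open>exp (g z)\<close> on the circle for a polynomial \<open>g\<close>. Then the
  integrand is the absolute value of the entire function \<open>p\<^sup>2 exp g\<close>, whose mean over the circle is
  its value at the centre; and the mean of \<open>Re g\<close>, close to that of \<open>h\<close>, is \<open>Re (g 0)\<close>.
\<close>

lemma szego_lower_bound: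
  fixes h :: "real \<Rightarrow> real" and p :: "complex poly"
  assumes h: "continuous_on {-1..1} h"
  shows "2 * pi * (exp (integral {0..2 * pi} (\<lambda>s. h (cos s)) / (2 * pi)) * (norm (poly p 0))\<^sup>2)
       \<le> integral {0..2 * pi} (\<lambda>s. exp (h (cos s)) * (norm (poly p (cis s)))\<^sup>2)" (is "?L \<le> ?R")
proof -
  let ?I = "integral {0..2 * pi} (\<lambda>s. h (cos s))"
  have ch: "continuous_on A (\<lambda>s. h (cos s))" for A
    by (rule continuous_on_compose2[OF h]) (auto intro!: continuous_intros)
  have ccis: "continuous_on A (\<lambda>s. poly q (cis s))" for A and q :: "complex poly"
    by (intro continuous_intros)
  have cR: "continuous_on A (\<lambda>s. exp (h (cos s)) * (norm (poly p (cis s)))\<^sup>2)" for A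
    by (intro continuous_intros ch ccis)
  have le: "?L \<le> exp (2 * e) * ?R" if e: "e > 0" for e
  proof -
    obtain g :: "complex poly" where g: "\<And>s. \<bar>h (cos s) - Re (poly g (cis s))\<bar> < e"
      using trig_poly_approx[OF h e] by blast
    define q where "q = (\<lambda>z. (poly p z)\<^sup>2 * exp (poly g z))"
    have nq: "norm (q z) = (norm (poly p z))\<^sup>2 * exp (Re (poly g z))" for z
      by (simp add: q_def norm_mult norm_power)
    have mq: "((\<lambda>s. q (cis s)) has_integral (2 * pi * q 0)) {0..2 * pi}"
      by (rule circle_mean_value) (auto simp: q_def intro!: holomorphic_intros)
    have "norm (2 * pi * q 0) \<le> integral {0..2 * pi} (\<lambda>s. exp e * (exp (h (cos s)) * (norm (poly p (cis s)))\<^sup>2))"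
      unfolding integral_unique[OF mq, symmetric]
    proof (rule integral_norm_bound_integral)
      show "(\<lambda>s. q (cis s)) integrable_on {0..2 * pi}" using mq by blast
      show "(\<lambda>s. exp e * (exp (h (cos s)) * (norm (poly p (cis s)))\<^sup>2)) integrable_on {0..2 * pi}"
        by (intro integrable_continuous_real continuous_on_mult continuous_on_const cR)
      fix s
      have "exp (Re (poly g (cis s))) \<le> exp e * exp (h (cos s))"
        using g[of s] by (simp add: exp_add[symmetric])
      from mult_right_mono[OF this, of "(norm (poly p (cis s)))\<^sup>2"]
      show "norm (q (cis s)) \<le> exp e * (exp (h (cos s)) * (norm (poly p (cis s)))\<^sup>2)"
        unfolding nq by (simp add: mult_ac)
    qed
    also have "\<dots> = exp e * ?R" by simp
    finally have 1: "2 * pi * ((norm (poly p 0))\<^sup>2 * exp (Re (poly g 0))) \<le> exp e * ?R"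
      by (simp add: norm_mult nq)
    have mg: "((\<lambda>s. poly g (cis s)) has_integral (2 * pi * poly g 0)) {0..2 * pi}"
      by (rule circle_mean_value) (auto intro!: holomorphic_intros)
    have mg': "((\<lambda>s. Re (poly g (cis s))) has_integral (2 * pi * Re (poly g 0))) {0..2 * pi}"
      using has_integral_Re[OF mg] by simp
    have "?I \<le> integral {0..2 * pi} (\<lambda>s. Re (poly g (cis s)) + e)"
    proof (rule integral_le)
      show "(\<lambda>s. h (cos s)) integrable_on {0..2 * pi}"
        by (rule integrable_continuous_real[OF ch])
      show "(\<lambda>s. Re (poly g (cis s)) + e) integrable_on {0..2 * pi}"
        by (intro integrable_continuous_real continuous_intros ccis)
      fix s
      show "h (cos s) \<le> Re (poly g (cis s)) + e" using g[of s] by linarith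
    qed
    also have "\<dots> = 2 * pi * (Re (poly g 0) + e)"
      using has_integral_add[OF mg' has_integral_const_real[of e 0 "2 * pi"]]
      by (simp add: integral_unique algebra_simps)
    finally have "?I / (2 * pi) \<le> Re (poly g 0) + e" by (simp add: field_simps)
    then have "exp (?I / (2 * pi)) \<le> exp (Re (poly g 0)) * exp e" by (simp add: exp_add[symmetric])
    then have "?L \<le> 2 * pi * (exp (Re (poly g 0)) * exp e * (norm (poly p 0))\<^sup>2)"
      by (intro mult_left_mono mult_right_mono) auto
    also have "\<dots> = exp e * (2 * pi * ((norm (poly p 0))\<^sup>2 * exp (Re (poly g 0))))" by simp
    also have "\<dots> \<le> exp e * (exp e * ?R)" using 1 by (intro mult_left_mono) auto
    also have "\<dots> = exp (2 * e) * ?R" by (simp add: exp_double power2_eq_square)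
    finally show ?thesis .
  qed
  have "((\<lambda>e. exp (2 * e) * ?R) \<longlongrightarrow> exp (2 * 0) * ?R) (at_right 0)"
    by (intro tendsto_intros)
  moreover have "eventually (\<lambda>e::real. ?L \<le> exp (2 * e) * ?R) (at_right 0)"
    using eventually_at_right_less[of 0] by eventually_elim (rule le)
  ultimately have "?L \<le> exp (2 * 0) * ?R"
    by (rule tendsto_lowerbound) simp
  then show ?thesis by simp
qed

lemma parseval:
  fixes a :: "int \<Rightarrow> real"
  assumes "finite X"
  shows "((\<lambda>s. (norm (\<Sum>x\<in>X. of_real (a x) * cis (of_int x * s)))\<^sup>2) has_integral (2 * pi * (\<Sum>x\<in>X. (a x)\<^sup>2))) {0..2 * pi}"
proof -
  have cosint: "((\<lambda>s. cos (of_int n * s)) has_integral (if n = 0 then 2 * pi else 0)) {0..2 * pi}" for n :: int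
  proof (cases "n = 0")
    case True
    then show ?thesis using has_integral_const_real[of "1::real" 0 "2 * pi"] by simp
  next
    case False
    have "((\<lambda>s. cos (of_int n * s)) has_integral (sin (of_int n * (2 * pi)) / of_int n - sin (of_int n * 0) / of_int n)) {0..2 * pi}"
    proof (rule fundamental_theorem_of_calculus)
      fix s
      have "((\<lambda>s. sin (of_int n * s) / of_int n) has_real_derivative cos (of_int n * s)) (at s within {0..2 * pi})"
        using False by (auto intro!: derivative_eq_intros)
      then show "((\<lambda>s. sin (of_int n * s) / of_int n) has_vector_derivative cos (of_int n * s)) (at s within {0..2 * pi})"
        by (simp add: has_real_derivative_iff_has_vector_derivative)
    qed simp
    moreover have "sin (of_int n * (2 * pi)) = 0"
      using sin_int_2pin[of n] by (simp add: mult.commute)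
    ultimately show ?thesis using False by simp
  qed
  have eq: "(norm (\<Sum>x\<in>X. of_real (a x) * cis (of_int x * s)))\<^sup>2
      = (\<Sum>x\<in>X. \<Sum>y\<in>X. a x * a y * cos (of_int (x - y) * s))" for s
    unfolding cmod_power2 Re_sum Im_sum
    unfolding power2_eq_square sum_product sum.distrib[symmetric]
    by (intro sum.cong refl) (simp add: cos_diff algebra_simps)
  have "((\<lambda>s. \<Sum>x\<in>X. \<Sum>y\<in>X. a x * a y * cos (of_int (x - y) * s)) has_integral
      (\<Sum>x\<in>X. \<Sum>y\<in>X. a x * a y * (if x - y = 0 then 2 * pi else 0))) {0..2 * pi}"
    by (intro has_integral_sum assms has_integral_mult_right cosint)
  moreover have "(\<Sum>x\<in>X. \<Sum>y\<in>X. a x * a y * (if x - y = 0 then 2 * pi else 0)) = 2 * pi * (\<Sum>x\<in>X. (a x)\<^sup>2)"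
    unfolding sum_distrib_left
  proof (rule sum.cong[OF refl])
    fix x assume "x \<in> X"
    have "(\<Sum>y\<in>X. a x * a y * (if x - y = 0 then 2 * pi else 0)) = (\<Sum>y\<in>X. if y = x then a x * a x * (2 * pi) else 0)"
      by (intro sum.cong refl) auto
    then show "(\<Sum>y\<in>X. a x * a y * (if x - y = 0 then 2 * pi else 0)) = 2 * pi * (a x)\<^sup>2"
      using assms \<open>x \<in> X\<close> by (simp add: sum.delta power2_eq_square)
  qed
  ultimately show ?thesis unfolding eq by simp
qed

section \<open>The Dirichlet energy of a function on a half-plane\<close>

text \<open>
  Eliminating the values \<open>G 1, G 2, \<dots>\<close> one after the other, from the far end: if the tail after \<open>G 1\<close>
  costs at least \<open>v\<close> times the squared size of \<open>G 1\<close>, then minimising over \<open>G 1\<close> shows the same after \<open>G 0\<close>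
  when \<open>v\<close> is a fixed point of \<open>v \<mapsto> (c + v) / (1 + c + v)\<close>, which is the first hypothesis.
\<close>

lemma half_line_energy:
  fixes G :: "nat \<Rightarrow> complex" and c v :: real
  assumes v: "v * (1 + c + v) = c + v" and pos: "1 + c + v > 0" and G: "G n = 0"
  shows "v * (norm (G 0))\<^sup>2 \<le> (\<Sum>k<n. c * (norm (G (Suc k)))\<^sup>2 + (norm (G (Suc k) - G k))\<^sup>2)"
  using G
proof (induction n arbitrary: G)
  case (Suc n)
  have real: "v * p\<^sup>2 \<le> (c + v) * x\<^sup>2 + (x - p)\<^sup>2" for x p :: real
  proof -
    \<comment> \<open>the completed square\<close>
    have "(1 + c + v) * ((c + v) * x\<^sup>2 + (x - p)\<^sup>2 - v * p\<^sup>2) = ((1 + c + v) * x - p)\<^sup>2"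
    proof -
      have "(1 + c + v) * (v * p\<^sup>2) = (c + v) * p\<^sup>2" unfolding v[symmetric] by (simp only: mult_ac)
      then show ?thesis by (simp add: power2_eq_square algebra_simps)
    qed
    then have "0 \<le> (1 + c + v) * ((c + v) * x\<^sup>2 + (x - p)\<^sup>2 - v * p\<^sup>2)" by simp
    then show ?thesis using pos by (simp add: zero_le_mult_iff)
  qed
  have "v * (norm (G 0))\<^sup>2 \<le> (c + v) * (norm (G 1))\<^sup>2 + (norm (G 1 - G 0))\<^sup>2"
    using real[of "Re (G 0)" "Re (G 1)"] real[of "Im (G 0)" "Im (G 1)"]
    by (simp add: cmod_power2 algebra_simps)
  also have "v * (norm (G 1))\<^sup>2 \<le> (\<Sum>k<n. c * (norm (G (Suc (Suc k))))\<^sup>2 + (norm (G (Suc (Suc k)) - G (Suc k)))\<^sup>2)"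
    using Suc.IH[of "\<lambda>k. G (Suc k)"] Suc.prems by simp
  then have "(c + v) * (norm (G 1))\<^sup>2 + (norm (G 1 - G 0))\<^sup>2
     \<le> c * (norm (G 1))\<^sup>2 + (norm (G 1 - G 0))\<^sup>2 + (\<Sum>k<n. c * (norm (G (Suc (Suc k))))\<^sup>2 + (norm (G (Suc (Suc k)) - G (Suc k)))\<^sup>2)"
    by (simp add: algebra_simps)
  also have "\<dots> = (\<Sum>k<Suc n. c * (norm (G (Suc k)))\<^sup>2 + (norm (G (Suc k) - G k))\<^sup>2)"
    unfolding sum.lessThan_Suc_shift by simp
  finally show ?case .
qed simp

text \<open>
  \<open>\<mu>\<close> is the larger root of \<open>\<mu> + 1 / \<mu> = 2 + c\<close>, and \<open>1 - 1 / \<mu>\<close> is the fixed point for the elimination of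
  rows. The root is \<open>exp (2 * arsinh \<sigma>)\<close> since \<open>c = 4 \<sigma>\<^sup>2\<close> with \<open>\<sigma> = \<bar>sin (s / 2)\<bar>\<close>; it is written in terms
  of \<open>cos s\<close> because the approximation by polynomials in \<open>cis s\<close> asks for a function of the cosine.
\<close>

lemma transfer_root:
  fixes s :: real
  defines "\<mu> \<equiv> exp (2 * arsinh (sqrt ((1 - cos s) / 2)))" and "c \<equiv> 2 - 2 * cos s"
  shows "(1 - 1 / \<mu>) * (1 + c + (1 - 1 / \<mu>)) = c + (1 - 1 / \<mu>)" "1 + c + (1 - 1 / \<mu>) = \<mu>" "\<mu> \<ge> 1"
proof -
  define \<sigma> where "\<sigma> = sqrt ((1 - cos s) / 2)"
  define r where "r = exp (arsinh \<sigma>)"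
  have \<sigma>2: "4 * \<sigma>\<^sup>2 = c" by (simp add: \<sigma>_def c_def)
  have r0: "r > 0" by (simp add: r_def)
  have \<mu>: "\<mu> = r\<^sup>2" by (simp add: \<mu>_def r_def \<sigma>_def exp_double)
  have "sinh (arsinh \<sigma>) = \<sigma>" by simp
  then have "r - 1 / r = 2 * \<sigma>" by (simp add: sinh_field_def r_def exp_minus inverse_eq_divide)
  then have "(r - 1 / r)\<^sup>2 = 4 * \<sigma>\<^sup>2" by (simp add: power_mult_distrib)
  then have "\<mu> + 1 / \<mu> - 2 = c" unfolding \<sigma>2 \<mu> using r0
    by (simp add: power2_diff power_one_over)
  then show 1: "1 + c + (1 - 1 / \<mu>) = \<mu>" by simp
  have "\<sigma> \<ge> 0" by (simp add: \<sigma>_def)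
  then have "arsinh \<sigma> \<ge> 0" using arsinh_real_neg_iff[of \<sigma>] by (meson not_le)
  then show "\<mu> \<ge> 1" by (simp add: \<mu>_def \<sigma>_def)
  show "(1 - 1 / \<mu>) * (1 + c + (1 - 1 / \<mu>)) = c + (1 - 1 / \<mu>)"
    unfolding 1 using 1 r0 \<mu> by (simp add: algebra_simps)
qed

lemma lattice_const_mean:
  "exp (integral {0..2 * pi} (\<lambda>s. 2 * arsinh (sqrt ((1 - cos s) / 2))) / (2 * pi)) = \<bb>"
proof -
  have "sqrt ((1 - cos s) / 2) = sin (s / 2)" if "s \<in> {0..2 * pi}" for s
  proof -
    have "(1 - cos s) / 2 = (sin (s / 2))\<^sup>2" using cos_double_sin[of "s / 2"] by simp
    moreover have "0 \<le> sin (s / 2)" using that by (intro sin_ge_zero) auto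
    ultimately show ?thesis by simp
  qed
  then have "integral {0..2 * pi} (\<lambda>s. 2 * arsinh (sqrt ((1 - cos s) / 2)))
    = integral {0..2 * pi} (\<lambda>s. 2 * arsinh (sin (s / 2)))"
    by (intro integral_cong) simp
  then show ?thesis unfolding integral_arsinh_sin lattice_const_def by simp
qed

lemma lattice_const_ge_1: "\<bb> \<ge> 1"
proof -
  have "sqrt ((1 - cos s) / 2) \<ge> 0" for s :: real by simp
  then have "2 * arsinh (sqrt ((1 - cos s) / 2)) \<ge> 0" for s :: real
    using arsinh_real_neg_iff[of "sqrt ((1 - cos s) / 2)"] by (metis mult_nonneg_nonneg not_le zero_le_numeral)
  then have "integral {0..2 * pi} (\<lambda>s. 2 * arsinh (sqrt ((1 - cos s) / 2))) \<ge> 0"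
    by (intro integral_nonneg integrable_continuous_real continuous_intros) auto
  then show ?thesis unfolding lattice_const_mean[symmetric] by simp
qed

text \<open>
  Szego's theorem for the quadratic form of the square lattice and the lexicographic half-plane of
  points that lie above row 0, or in row 0 up to the origin.
\<close>

lemma half_plane_energy:
  fixes f :: "int \<Rightarrow> int \<Rightarrow> real" and N :: nat
  assumes supp: "\<And>x y. f x y \<noteq> 0 \<Longrightarrow> \<bar>x\<bar> < int N \<and> 0 \<le> y \<and> y < int N"
    and row: "\<And>x. x > 0 \<Longrightarrow> f x 0 = 0"
  shows "\<bb> * (f 0 0)\<^sup>2 \<le> (\<Sum>y = 0..int N. \<Sum>x = - int N..int N.
            (f x y - f (x + 1) y)\<^sup>2 + (f x y - f x (y - 1))\<^sup>2)" (is "_ \<le> ?E")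
proof -
  define X where "X = {- int N..int N}"
  \<comment> \<open>\<open>F y\<close> is the Fourier series of row \<open>y\<close>; \<open>p\<close> is the conjugate of \<open>F 0\<close> on the circle, a polynomial because row 0 is one-sided\<close>
  define F where "F = (\<lambda>y s. \<Sum>x\<in>X. of_real (f x y) * cis (of_int x * s))"
  define c where "c = (\<lambda>s::real. 2 - 2 * cos s)"
  define h where "h = (\<lambda>t. 2 * arsinh (sqrt ((1 - t) / 2)))"
  define p where "p = (\<Sum>k\<le>N. monom (complex_of_real (f (- int k) 0)) k)"
  have finX: "finite X" by (simp add: X_def)
  have shift: "(\<Sum>x\<in>X. of_real (f (x + 1) y) * cis (of_int x * s)) = cis (- s) * F y s" for y s
  proof -
    have "(\<Sum>x\<in>X. of_real (f (x + 1) y) * cis (of_int x * s))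
        = (\<Sum>x\<in>{- int N + 1..int N + 1}. of_real (f x y) * cis (of_int (x - 1) * s))"
      by (rule sum.reindex_bij_witness[where i = "\<lambda>x. x - 1" and j = "\<lambda>x. x + 1"]) (auto simp: X_def)
    also have "\<dots> = (\<Sum>x\<in>X. of_real (f x y) * cis (of_int (x - 1) * s))"
      by (rule sum.mono_neutral_cong) (use supp[of _ y] in \<open>force simp: X_def\<close>)+
    also have "\<dots> = cis (- s) * F y s"
      unfolding F_def sum_distrib_left
      by (intro sum.cong refl) (simp add: left_diff_distrib cis_divide[symmetric] cis_inverse[symmetric] field_simps)
    finally show ?thesis .
  qed
  have horizontal: "((\<lambda>s. c s * (norm (F y s))\<^sup>2) has_integral (2 * pi * (\<Sum>x\<in>X. (f x y - f (x + 1) y)\<^sup>2))) {0..2 * pi}" for y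
  proof -
    have "(norm (\<Sum>x\<in>X. of_real (f x y - f (x + 1) y) * cis (of_int x * s)))\<^sup>2 = c s * (norm (F y s))\<^sup>2" for s
    proof -
      have "(\<Sum>x\<in>X. of_real (f x y - f (x + 1) y) * cis (of_int x * s)) = (1 - cis (- s)) * F y s"
        using shift[of y s] by (simp add: left_diff_distrib sum_subtractf F_def)
      moreover have "(norm (1 - cis (- s)))\<^sup>2 = c s"
        using sin_cos_squared_add[of s] by (simp add: cmod_power2 c_def power2_diff)
      ultimately show ?thesis by (simp add: norm_mult power_mult_distrib)
    qed
    with parseval[OF finX, of "\<lambda>x. f x y - f (x + 1) y"] show ?thesis by simp
  qed
  have vertical: "((\<lambda>s. (norm (F y s - F (y - 1) s))\<^sup>2) has_integral (2 * pi * (\<Sum>x\<in>X. (f x y - f x (y - 1))\<^sup>2))) {0..2 * pi}" for y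
    using parseval[OF finX, of "\<lambda>x. f x y - f x (y - 1)"]
    by (simp add: F_def left_diff_distrib sum_subtractf)
  have total: "((\<lambda>s. \<Sum>y = 0..int N. c s * (norm (F y s))\<^sup>2 + (norm (F y s - F (y - 1) s))\<^sup>2) has_integral
      (\<Sum>y = 0..int N. 2 * pi * (\<Sum>x\<in>X. (f x y - f (x + 1) y)\<^sup>2) + 2 * pi * (\<Sum>x\<in>X. (f x y - f x (y - 1))\<^sup>2))) {0..2 * pi}"
    by (intro has_integral_sum has_integral_add horizontal vertical) auto
  have total_eq: "(\<Sum>y = 0..int N. 2 * pi * (\<Sum>x\<in>X. (f x y - f (x + 1) y)\<^sup>2) + 2 * pi * (\<Sum>x\<in>X. (f x y - f x (y - 1))\<^sup>2)) = 2 * pi * ?E"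
    by (simp add: X_def sum.distrib sum_distrib_left distrib_left)
  have pF: "norm (poly p (cis s)) = norm (F 0 s)" for s
  proof -
    have "F 0 s = (\<Sum>x\<in>(\<lambda>k. - int k) ` {..N}. of_real (f x 0) * cis (of_int x * s))"
      unfolding F_def
    proof (rule sum.mono_neutral_right[OF finX])
      show "(\<lambda>k. - int k) ` {..N} \<subseteq> X" by (auto simp: X_def)
      show "\<forall>x\<in>X - (\<lambda>k. - int k) ` {..N}. complex_of_real (f x 0) * cis (of_int x * s) = 0"
      proof
        fix x assume x: "x \<in> X - (\<lambda>k. - int k) ` {..N}"
        have "x > 0"
        proof (rule ccontr)
          assume "\<not> x > 0"
          then have "x = - int (nat (- x))" "nat (- x) \<le> N" using x by (auto simp: X_def)
          with x show False by blast
        qed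
        then show "complex_of_real (f x 0) * cis (of_int x * s) = 0" using row by simp
      qed
    qed
    also have "\<dots> = (\<Sum>k\<le>N. of_real (f (- int k) 0) * cis (- (of_nat k * s)))"
      by (subst sum.reindex) (auto simp: inj_on_def)
    also have "\<dots> = (\<Sum>k\<le>N. of_real (f (- int k) 0) * cis (- s) ^ k)"
      by (intro sum.cong refl) (simp only: Complex.DeMoivre mult_minus_right)
    also have "\<dots> = cnj (poly p (cis s))"
      by (simp add: p_def poly_sum poly_monom cnj_sum cis_cnj)
    finally show ?thesis by simp
  qed
  have p0: "poly p 0 = of_real (f 0 0)"
    by (simp add: p_def poly_sum poly_monom power_0_left sum.delta if_distrib cong: if_cong)
  \<comment> \<open>for fixed \<open>s\<close> the rows form a sequence that starts with \<open>F (-1) = 0\<close> and ends with \<open>F N = 0\<close>\<close>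
  have lower: "exp (h (cos s)) * (norm (F 0 s))\<^sup>2
      \<le> (\<Sum>y = 0..int N. c s * (norm (F y s))\<^sup>2 + (norm (F y s - F (y - 1) s))\<^sup>2)" for s
  proof -
    define G where "G = (\<lambda>k. F (int k) s)"
    define v where "v = 1 - 1 / exp (h (cos s))"
    have tr: "v * (1 + c s + v) = c s + v" "1 + c s + v = exp (h (cos s))" "exp (h (cos s)) \<ge> 1"
      unfolding v_def h_def c_def by (rule transfer_root)+
    have neg: "F (- 1) s = 0" using supp[of _ "-1"] by (force simp: F_def intro!: sum.neutral)
    have "G N = 0" using supp[of _ "int N"] by (force simp: G_def F_def intro!: sum.neutral)
    moreover have "1 + c s + v > 0" using tr(2,3) by simp
    ultimately have "v * (norm (G 0))\<^sup>2 \<le> (\<Sum>k<N. c s * (norm (G (Suc k)))\<^sup>2 + (norm (G (Suc k) - G k))\<^sup>2)"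
      using half_line_energy[of v "c s" G N] tr(1) by simp
    then have "(1 + c s + v) * (norm (G 0))\<^sup>2
        \<le> c s * (norm (G 0))\<^sup>2 + (norm (G 0))\<^sup>2 + (\<Sum>k<N. c s * (norm (G (Suc k)))\<^sup>2 + (norm (G (Suc k) - G k))\<^sup>2)"
      by (simp add: algebra_simps)
    also have "\<dots> = (\<Sum>k<Suc N. c s * (norm (F (int k) s))\<^sup>2 + (norm (F (int k) s - F (int k - 1) s))\<^sup>2)"
      unfolding sum.lessThan_Suc_shift by (simp add: G_def neg)
    also have "\<dots> = (\<Sum>y = 0..int N. c s * (norm (F y s))\<^sup>2 + (norm (F y s - F (y - 1) s))\<^sup>2)"
      by (rule sum.reindex_bij_witness[where i = nat and j = int]) auto
    finally show ?thesis unfolding tr(2) by (simp add: G_def)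
  qed
  have ch: "continuous_on {-1..1} h"
    unfolding h_def by (intro continuous_intros) auto
  have "2 * pi * (\<bb> * (f 0 0)\<^sup>2)
      \<le> integral {0..2 * pi} (\<lambda>s. exp (h (cos s)) * (norm (poly p (cis s)))\<^sup>2)"
    using szego_lower_bound[OF ch, of p] lattice_const_mean unfolding p0 h_def by simp
  also have "\<dots> = integral {0..2 * pi} (\<lambda>s. exp (h (cos s)) * (norm (F 0 s))\<^sup>2)"
    unfolding pF ..
  also have "\<dots> \<le> integral {0..2 * pi} (\<lambda>s. \<Sum>y = 0..int N. c s * (norm (F y s))\<^sup>2 + (norm (F y s - F (y - 1) s))\<^sup>2)"
  proof (rule integral_le)
    have "continuous_on {0..2 * pi} (\<lambda>s. h (cos s))"
      by (rule continuous_on_compose2[OF ch]) (auto intro!: continuous_intros)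
    then show "(\<lambda>s. exp (h (cos s)) * (norm (F 0 s))\<^sup>2) integrable_on {0..2 * pi}"
      unfolding pF[symmetric] by (intro integrable_continuous_real continuous_intros)
    show "(\<lambda>s. \<Sum>y = 0..int N. c s * (norm (F y s))\<^sup>2 + (norm (F y s - F (y - 1) s))\<^sup>2) integrable_on {0..2 * pi}"
      using total by blast
  qed (rule lower)
  also have "\<dots> = 2 * pi * ?E" using integral_unique[OF total] total_eq by simp
  finally show ?thesis by simp
qed

section \<open>Circulations on the square lattice\<close>

abbreviation up :: "int \<times> int \<Rightarrow> int \<times> int" where "up p \<equiv> (fst p, snd p + 1)"
abbreviation left :: "int \<times> int \<Rightarrow> int \<times> int" where "left p \<equiv> (fst p - 1, snd p)"

definition lattice_arcs :: "((int \<times> int) \<times> (int \<times> int)) set" where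
  "lattice_arcs = {(p, q). q = up p \<or> q = left p \<or> p = up q \<or> p = left q}"

text \<open>
  Reading order: rows from top to bottom, each from left to right.
\<close>

definition later :: "int \<times> int \<Rightarrow> int \<times> int \<Rightarrow> bool" where
  "later v p \<longleftrightarrow> snd p < snd v \<or> (snd p = snd v \<and> fst p > fst v)"

lemma lattice_sum:
  fixes \<theta> :: "int \<times> int \<Rightarrow> int \<times> int \<Rightarrow> real"
  assumes fin: "finite V" and supp: "\<And>p q. \<theta> p q \<noteq> 0 \<Longrightarrow> (p, q) \<in> lattice_arcs \<and> q \<in> V"
  shows "(\<Sum>q\<in>V. \<theta> (x, y) q)
    = \<theta> (x, y) (x, y + 1) + \<theta> (x, y) (x - 1, y) + \<theta> (x, y) (x, y - 1) + \<theta> (x, y) (x + 1, y)"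
proof -
  let ?N = "{(x, y + 1), (x - 1, y), (x, y - 1), (x + 1, y)}"
  have "(\<Sum>q\<in>V. \<theta> (x, y) q) = (\<Sum>q\<in>?N. \<theta> (x, y) q)"
  proof (rule sum.mono_neutral_cong)
    fix q assume "q \<in> ?N - V"
    then show "\<theta> (x, y) q = 0" using supp by blast
  next
    fix q assume "q \<in> V - ?N"
    then have "((x, y), q) \<notin> lattice_arcs" by (cases q) (auto simp: lattice_arcs_def)
    then show "\<theta> (x, y) q = 0" using supp by blast
  qed (use fin in auto)
  then show ?thesis by simp
qed

text \<open>
  The height function \<open>f\<close> of the circulation: its value on a square is the upward flow
  through the right side of the square and all vertical edges further right in the row.
  By definition \<open>f\<close> drops by the vertical flow between horizontal neighbours. Between vertical neighbours it drops by the horizontal flow: the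
  defect does not change along a row, by conservation at the common vertex, and it is 0 far to
  the right. Coordinates are shifted to put \<open>v\<close> at the origin; the square with index \<open>(x, y)\<close> has
  its bottom-right corner there.
\<close>

lemma circulation_energy:
  fixes \<theta> :: "int \<times> int \<Rightarrow> int \<times> int \<Rightarrow> real"
  assumes fin: "finite V"
    and supp: "\<And>p q. \<theta> p q \<noteq> 0 \<Longrightarrow> (p, q) \<in> lattice_arcs \<and> p \<in> V \<and> q \<in> V"
    and anti: "\<And>p q. \<theta> p q = - \<theta> q p"
    and div: "\<And>p. p \<in> V \<Longrightarrow> (\<Sum>q\<in>V. \<theta> p q) = 0"
    and late: "\<And>p q. later v p \<Longrightarrow> \<theta> p q = 0"
  shows "2 * (\<bb> * (\<theta> v (up v))\<^sup>2) \<le> (\<Sum>p\<in>V. \<Sum>q\<in>V. (\<theta> p q)\<^sup>2)"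
proof -
  obtain a b where v: "v = (a, b)" by (cases v)
  define U where "U = (\<lambda>x y. \<theta> (a + x, b + y) (a + x, b + y + 1))"
  define R where "R = (\<lambda>x y. \<theta> (a + x, b + y) (a + x + 1, b + y))"
  obtain N :: nat where N: "\<And>p. p \<in> V \<Longrightarrow> \<bar>fst p - a\<bar> < int N \<and> \<bar>snd p - b\<bar> < int N"
  proof -
    define M where "M = Max (insert 0 ((\<lambda>p. \<bar>fst p - a\<bar> + \<bar>snd p - b\<bar>) ` V))"
    have "\<bar>fst p - a\<bar> + \<bar>snd p - b\<bar> \<le> M" if "p \<in> V" for p
      unfolding M_def using fin that by (intro Max_ge) auto
    moreover have "0 \<le> M" unfolding M_def using fin by (intro Max_ge) auto
    ultimately show thesis using that[of "nat (M + 1)"] by force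
  qed
  have U: "\<bar>x\<bar> < int N \<and> 0 \<le> y \<and> y < int N \<and> (y = 0 \<longrightarrow> x \<le> 0)" if "U x y \<noteq> 0" for x y
  proof -
    have "(a + x, b + y) \<in> V" using supp that by (auto simp: U_def)
    moreover have "\<not> later v (a + x, b + y)" using late that by (auto simp: U_def)
    ultimately show ?thesis using N by (fastforce simp: later_def v)
  qed
  have R: "\<bar>x\<bar> < int N" "\<bar>x + 1\<bar> < int N" if "R x y \<noteq> 0" for x y
    using supp[of "(a + x, b + y)" "(a + x + 1, b + y)"] that N[of "(a + x, b + y)"] N[of "(a + x + 1, b + y)"]
    by (auto simp: R_def)
  have kirchhoff: "R x y - R (x - 1) y + U x y - U x (y - 1) = 0" for x y
  proof -
    have "(\<Sum>q\<in>V. \<theta> (a + x, b + y) q) = 0"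
    proof (cases "(a + x, b + y) \<in> V")
      case False
      then have "\<theta> (a + x, b + y) q = 0" for q using supp by blast
      then show ?thesis by simp
    qed (rule div)
    moreover have "(\<Sum>q\<in>V. \<theta> (a + x, b + y) q) = R x y - R (x - 1) y + U x y - U x (y - 1)"
      using lattice_sum[OF fin, of \<theta> "a + x" "b + y"] supp
        anti[of "(a + x, b + y)" "(a + x - 1, b + y)"] anti[of "(a + x, b + y)" "(a + x, b + y - 1)"]
      by (simp add: R_def U_def add_diff_eq)
    ultimately show ?thesis by simp
  qed
  define f where "f = (\<lambda>x y. \<Sum>x'\<in>{x..int N}. U x' y)"
  have fU: "f x y - f (x + 1) y = U x y" for x y
  proof (cases "x \<le> int N")
    case True
    then have "{x..int N} = insert x {x + 1..int N}" by auto
    then show ?thesis by (simp add: f_def)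
  next
    case False
    then show ?thesis using U[of x y] by (force simp: f_def)
  qed
  have fR: "f x y - f x (y - 1) = R (x - 1) y" for x y
  proof -
    define g where "g = (\<lambda>x. f x y - f x (y - 1) - R (x - 1) y)"
    have step: "g x = g (x + 1)" for x
      using fU[of x y] fU[of x "y - 1"] kirchhoff[of x y] by (simp add: g_def)
    have far: "g x = 0" if "x > int N" for x
      using that R[of "x - 1" y] by (force simp: g_def f_def)
    have "g (int N + 1 - int k) = 0" for k
    proof (induction k)
      case (Suc k)
      have "int N + 1 - int (Suc k) + 1 = int N + 1 - int k" by simp
      with Suc step[of "int N + 1 - int (Suc k)"] show ?case by (simp only:)
    qed (simp add: far)
    from this[of "nat (int N + 1 - x)"] have "g x = 0" if "x \<le> int N"
      using that by simp
    then have "g x = 0" using far by (cases "x \<le> int N") auto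
    then show ?thesis by (simp add: g_def)
  qed
  have neg: "f x y = 0" if "y < 0" for x y
    unfolding f_def using U[of _ y] that by (intro sum.neutral) force
  \<comment> \<open>far to the left, the vertical differences vanish as well, and \<open>f\<close> is 0 below the lowest row\<close>
  have left0: "f x y = 0" if "x \<le> - int N" for x y
  proof -
    have "f x (int k - 1) = 0" for k
    proof (induction k)
      case (Suc k)
      have "R (x - 1) (int k) = 0" using R(1)[of "x - 1" "int k"] that by force
      then show ?case using Suc fR[of x "int k"] by simp
    qed (simp add: neg)
    from this[of "nat (y + 1)"] neg[of y x] show ?thesis by (cases "y < 0") simp_all
  qed
  have f_supp: "\<bar>x\<bar> < int N \<and> 0 \<le> y \<and> y < int N" if nz: "f x y \<noteq> 0" for x y
  proof -
    obtain x' where "x' \<in> {x..int N}" "U x' y \<noteq> 0"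
      using sum.not_neutral_contains_not_neutral[OF nz[unfolded f_def]] .
    then show ?thesis using U[of x' y] left0[of x y] nz by force
  qed
  have f_row: "f x 0 = 0" if "x > 0" for x
    unfolding f_def using U[of _ 0] that by (intro sum.neutral) force
  have f00: "f 0 0 = \<theta> v (up v)" using fU[of 0 0] f_row[of 1] by (simp add: U_def v)
  define \<psi> where "\<psi> = (\<lambda>p. (\<theta> p (up p))\<^sup>2 + (\<theta> p (left p))\<^sup>2)"
  define B where "B = (\<lambda>(y, x). (a + x, b + y)) ` ({0..int N} \<times> {- int N..int N})"
  have \<psi>V: "\<psi> p = 0" if "p \<notin> V" for p
    using supp[of p "up p"] supp[of p "left p"] that unfolding \<psi>_def by fastforce
  have "\<bb> * (\<theta> v (up v))\<^sup>2 \<le> (\<Sum>y = 0..int N. \<Sum>x = - int N..int N. (f x y - f (x + 1) y)\<^sup>2 + (f x y - f x (y - 1))\<^sup>2)"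
    using half_plane_energy[of f N] f_supp f_row f00 by simp
  also have "\<dots> = (\<Sum>y = 0..int N. \<Sum>x = - int N..int N. \<psi> (a + x, b + y))"
  proof (intro sum.cong refl)
    fix x y
    have "R (x - 1) y = - \<theta> (a + x, b + y) (a + x - 1, b + y)"
      using anti[of "(a + x, b + y)" "(a + x - 1, b + y)"] by (simp add: R_def add_diff_eq)
    then show "(f x y - f (x + 1) y)\<^sup>2 + (f x y - f x (y - 1))\<^sup>2 = \<psi> (a + x, b + y)"
      unfolding fU fR by (simp add: \<psi>_def U_def)
  qed
  also have "\<dots> = (\<Sum>(y, x)\<in>{0..int N} \<times> {- int N..int N}. \<psi> (a + x, b + y))"
    by (simp add: sum.cartesian_product)
  also have "\<dots> = (\<Sum>p\<in>B. \<psi> p)"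
    unfolding B_def by (subst sum.reindex) (auto simp: inj_on_def case_prod_unfold)
  also have "\<dots> = (\<Sum>p\<in>B \<inter> V. \<psi> p)"
    by (rule sum.mono_neutral_right) (use \<psi>V in \<open>auto simp: B_def\<close>)
  also have "\<dots> \<le> (\<Sum>p\<in>V. \<psi> p)"
    by (rule sum_mono2) (use fin in \<open>auto simp: \<psi>_def\<close>)
  finally have low: "\<bb> * (\<theta> v (up v))\<^sup>2 \<le> (\<Sum>p\<in>V. \<psi> p)" .
  \<comment> \<open>every edge carries two arcs, exactly one of which points up or left\<close>
  define D where "D = (\<lambda>p q. q = up p \<or> q = left p)"
  have split: "(\<Sum>p\<in>V. \<Sum>q\<in>V. (\<theta> p q)\<^sup>2) = (\<Sum>p\<in>V. \<Sum>q\<in>V. of_bool (D p q) * (\<theta> p q)\<^sup>2 + of_bool (D q p) * (\<theta> p q)\<^sup>2)"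
  proof (intro sum.cong refl)
    fix p q
    show "(\<theta> p q)\<^sup>2 = of_bool (D p q) * (\<theta> p q)\<^sup>2 + of_bool (D q p) * (\<theta> p q)\<^sup>2"
    proof (cases "\<theta> p q = 0")
      case False
      then have "D p q \<or> D q p" using supp[OF False] by (auto simp: lattice_arcs_def D_def)
      moreover have "\<not> (D p q \<and> D q p)" by (cases p; cases q) (auto simp: D_def)
      ultimately show ?thesis by auto
    qed simp
  qed
  have "(\<Sum>p\<in>V. \<Sum>q\<in>V. of_bool (D q p) * (\<theta> p q)\<^sup>2) = (\<Sum>q\<in>V. \<Sum>p\<in>V. of_bool (D q p) * (\<theta> p q)\<^sup>2)"
    by (rule sum.swap)
  also have "\<dots> = (\<Sum>q\<in>V. \<Sum>p\<in>V. of_bool (D q p) * (\<theta> q p)\<^sup>2)"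
    by (intro sum.cong refl) (metis anti power2_minus)
  finally have flip: "(\<Sum>p\<in>V. \<Sum>q\<in>V. of_bool (D q p) * (\<theta> p q)\<^sup>2) = (\<Sum>p\<in>V. \<Sum>q\<in>V. of_bool (D p q) * (\<theta> p q)\<^sup>2)" .
  have directed: "(\<Sum>p\<in>V. \<Sum>q\<in>V. of_bool (D p q) * (\<theta> p q)\<^sup>2) = (\<Sum>p\<in>V. \<psi> p)"
  proof (rule sum.cong[OF refl])
    fix p
    have d: "(\<Sum>q\<in>V. if q = r then (\<theta> p q)\<^sup>2 else 0) = (\<theta> p r)\<^sup>2" for r
      using fin supp[of p r] by (auto simp: sum.delta)
    have "(\<Sum>q\<in>V. of_bool (D p q) * (\<theta> p q)\<^sup>2)
      = (\<Sum>q\<in>V. (if q = up p then (\<theta> p q)\<^sup>2 else 0) + (if q = left p then (\<theta> p q)\<^sup>2 else 0))"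
      by (intro sum.cong refl) (auto simp: D_def)
    then show "(\<Sum>q\<in>V. of_bool (D p q) * (\<theta> p q)\<^sup>2) = \<psi> p"
      unfolding sum.distrib d \<psi>_def .
  qed
  show ?thesis
    unfolding split sum.distrib flip unfolding directed using low by linarith
qed

section \<open>Deleting edges in lexicographic order\<close>

definition square_arcs :: "int \<times> int \<Rightarrow> ((int \<times> int) \<times> (int \<times> int)) set" where
  "square_arcs v = parcs (unit_square v)"

lemma square_arcs_simp:
  "square_arcs (x, y) =
    {((x, y), (x - 1, y)), ((x - 1, y), (x - 1, y + 1)), ((x - 1, y + 1), (x, y + 1)), ((x, y + 1), (x, y)),
     ((x - 1, y), (x, y)), ((x - 1, y + 1), (x - 1, y)), ((x, y + 1), (x - 1, y + 1)), ((x, y), (x, y + 1))}"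
  by (auto simp: square_arcs_def Let_def)

lemma path3_not_bridge:
  assumes "(p, a) \<in> del_edge E p q" "(a, b) \<in> del_edge E p q" "(b, q) \<in> del_edge E p q"
  shows "\<not> is_bridge E p q"
  unfolding is_bridge_def not_not
  using rtrancl_into_rtrancl[OF rtrancl_into_rtrancl[OF r_into_rtrancl[OF assms(1)] assms(2)] assms(3)] .

text \<open>
  The other three sides are a detour.
\<close>

lemma square_no_bridge:
  assumes E: "square_arcs v \<subseteq> E" and pq: "(p, q) \<in> square_arcs v"
  shows "\<not> is_bridge E p q"
proof -
  obtain x y where v: "v = (x, y)" by (cases v)
  have mem: "e \<in> E" if "e \<in> square_arcs (x, y)" for e using E that v by blast
  note m = mem[unfolded square_arcs_simp]
  let ?a = "(x, y)" and ?b = "(x - 1, y)" and ?c = "(x - 1, y + 1)" and ?d = "(x, y + 1)"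
  have "\<not> is_bridge E ?a ?b" by (rule path3_not_bridge[of _ ?d _ _ ?c]) (auto simp: del_edge_def intro!: m)
  moreover have "\<not> is_bridge E ?b ?a" by (rule path3_not_bridge[of _ ?c _ _ ?d]) (auto simp: del_edge_def intro!: m)
  moreover have "\<not> is_bridge E ?b ?c" by (rule path3_not_bridge[of _ ?a _ _ ?d]) (auto simp: del_edge_def intro!: m)
  moreover have "\<not> is_bridge E ?c ?b" by (rule path3_not_bridge[of _ ?d _ _ ?a]) (auto simp: del_edge_def intro!: m)
  moreover have "\<not> is_bridge E ?c ?d" by (rule path3_not_bridge[of _ ?b _ _ ?a]) (auto simp: del_edge_def intro!: m)
  moreover have "\<not> is_bridge E ?d ?c" by (rule path3_not_bridge[of _ ?a _ _ ?b]) (auto simp: del_edge_def intro!: m)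
  moreover have "\<not> is_bridge E ?d ?a" by (rule path3_not_bridge[of _ ?c _ _ ?b]) (auto simp: del_edge_def intro!: m)
  moreover have "\<not> is_bridge E ?a ?d" by (rule path3_not_bridge[of _ ?b _ _ ?c]) (auto simp: del_edge_def intro!: m)
  ultimately show ?thesis using pq unfolding v square_arcs_simp by blast
qed

lemma finite_squares:
  assumes "finite E" shows "finite {v. square_arcs v \<subseteq> E}"
proof (rule finite_subset)
  show "{v. square_arcs v \<subseteq> E} \<subseteq> fst ` E"
  proof
    fix v assume "v \<in> {v. square_arcs v \<subseteq> E}"
    then show "v \<in> fst ` E" by (cases v) (force simp: square_arcs_simp)
  qed
qed (use assms in simp)

lemma last_vertex:
  assumes "finite S" "S \<noteq> {}"
  obtains v where "v \<in> S" "\<And>p. p \<in> S \<Longrightarrow> \<not> later v p"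
proof -
  define b where "b = Min (snd ` S)"
  define A where "A = {p \<in> S. snd p = b}"
  define a where "a = Max (fst ` A)"
  have b: "b \<in> snd ` S" "\<And>p. p \<in> S \<Longrightarrow> b \<le> snd p" unfolding b_def using assms by auto
  have A: "finite A" "A \<noteq> {}" using assms b(1) by (auto simp: A_def)
  then have "a \<in> fst ` A" unfolding a_def by auto
  then obtain v where v: "v \<in> A" "fst v = a" by auto
  have "fst p \<le> a" if "p \<in> A" for p unfolding a_def using A that by auto
  then have "\<not> later v p" if "p \<in> S" for p
    using that v b(2)[OF that] by (fastforce simp: later_def A_def)
  then show thesis using that[of v] v by (auto simp: A_def)
qed

text \<open>
  Among the non-bridges \<open>B\<close> the deleted edge joins their last vertex \<open>v\<close> to its left or upper neighbour. The edges
  of a unit square are never bridges, so a square through the deleted edge has all its corners up to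
  \<open>v\<close> in the order. Its bottom-right corner is its last one, hence equals \<open>v\<close>: only one square is lost.
\<close>

lemma grid_tree_bound:
  assumes fin: "finite V" and "E \<subseteq> V \<times> V" "sym E" "E \<subseteq> lattice_arcs" "connects V E"
  shows "\<bb> ^ card {v. square_arcs v \<subseteq> E} \<le> card (trees V E)"
  using assms(2-)
proof (induction "card E" arbitrary: E rule: less_induct)
  case less
  note EV = \<open>E \<subseteq> V \<times> V\<close> and s = \<open>sym E\<close> and lat = \<open>E \<subseteq> lattice_arcs\<close> and conn = \<open>connects V E\<close>
  have finE: "finite E" using EV fin by (meson finite_SigmaI finite_subset)
  define B where "B = {(p, q) \<in> E. \<not> is_bridge E p q}"
  have squareB: "square_arcs v \<subseteq> B" if "square_arcs v \<subseteq> E" for v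
    using that square_no_bridge[OF that] by (auto simp: B_def)
  show ?case
  proof (cases "B = {}")
    case True
    have "\<not> square_arcs v \<subseteq> E" for v
      using squareB[of v] True by (cases v) (auto simp: square_arcs_simp)
    moreover have "card (trees V E) \<ge> 1"
      using trees_nonempty[OF finE s conn] finite_trees[OF finE] by (simp add: Suc_leI card_gt_0_iff)
    ultimately show ?thesis by simp
  next
    case False
    have "finite B" using finE by (rule finite_subset[rotated]) (auto simp: B_def)
    then obtain v where v: "v \<in> fst ` B" and last: "\<And>p. p \<in> fst ` B \<Longrightarrow> \<not> later v p"
      using last_vertex[of "fst ` B"] False by auto
    obtain q where vq: "(v, q) \<in> B" using v by auto
    have symB: "(y, x) \<in> B" if "(x, y) \<in> B" for x y
      using that symD[OF s] is_bridge_commute[OF s] by (auto simp: B_def)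
    have vqE: "(v, q) \<in> E" and nb: "\<not> is_bridge E v q" using vq by (auto simp: B_def)
    have "v \<noteq> q" using lat vqE by (cases v; cases q) (auto simp: lattice_arcs_def)
    have inB: "\<not> later v p" if "(p, r) \<in> B" for p r
      using last[of p] that by (metis fst_conv image_eqI)
    have "\<not> later v q" using inB[OF symB[OF vq]] .
    then have q: "q = left v \<or> q = up v"
      using lat vqE by (cases v; cases q) (auto simp: lattice_arcs_def later_def)
    let ?H = "del_edge E v q"
    have HE: "?H \<subseteq> E" by (rule del_edge_subset)
    have connH: "connects V ?H" by (rule connects_del_nonbridge[OF conn s nb])
    have cardH: "card ?H < card E"
      by (rule psubset_card_mono[OF finE]) (use vqE in \<open>auto simp: del_edge_def\<close>)
    have IH: "\<bb> ^ card {v. square_arcs v \<subseteq> ?H} \<le> card (trees V ?H)"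
      by (rule less.hyps[OF cardH]) (use HE EV lat connH sym_edge_ops(1)[OF s] in auto)
    obtain \<theta> :: "int \<times> int \<Rightarrow> int \<times> int \<Rightarrow> real" where
      anti: "\<And>x y. \<theta> x y = - \<theta> y x" and supp: "\<And>x y. (x, y) \<notin> E \<Longrightarrow> \<theta> x y = 0"
      and bridge: "\<And>x y. is_bridge E x y \<Longrightarrow> \<theta> x y = 0" and one: "\<theta> v q = 1"
      and div: "\<And>x. x \<in> V \<Longrightarrow> (\<Sum>y\<in>V. \<theta> x y) = 0"
      and energy: "(\<Sum>x\<in>V. \<Sum>y\<in>V. (\<theta> x y)\<^sup>2) * card (trees V ?H) = 2 * card (trees V E)"
      using deletion_flow[OF fin EV s vqE \<open>v \<noteq> q\<close> connH] by blast
    have late: "\<theta> p r = 0" if "later v p" for p r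
    proof -
      have "(p, r) \<notin> B" using inB that by blast
      then show ?thesis using supp[of p r] bridge[of p r] unfolding B_def by blast
    qed
    have supp': "(p, r) \<in> lattice_arcs \<and> p \<in> V \<and> r \<in> V" if "\<theta> p r \<noteq> 0" for p r
      using supp[of p r] that lat EV by blast
    \<comment> \<open>only the left and the upper edge at \<open>v\<close> carry flow, so conservation makes both flows 1 in absolute value\<close>
    have "(\<theta> v (up v))\<^sup>2 = 1"
    proof (cases "q = up v")
      case True
      then show ?thesis using one by simp
    next
      case False
      obtain x y where xy: "v = (x, y)" by (cases v)
      have "\<theta> (x, y) (x, y - 1) = 0" "\<theta> (x, y) (x + 1, y) = 0"
        using late[of "(x, y - 1)" "(x, y)"] late[of "(x + 1, y)" "(x, y)"]
          anti[of "(x, y)" "(x, y - 1)"] anti[of "(x, y)" "(x + 1, y)"]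
        by (simp_all add: later_def xy)
      moreover have "v \<in> V" using EV vqE by auto
      moreover have "\<theta> v (left v) = 1" using False q one by auto
      ultimately have "\<theta> v (up v) = - 1"
        using div[of v] lattice_sum[OF fin, of \<theta> x y] supp' by (simp add: xy)
      then show ?thesis by simp
    qed
    with circulation_energy[where v = v, OF fin supp' anti div late]
    have "2 * \<bb> \<le> (\<Sum>x\<in>V. \<Sum>y\<in>V. (\<theta> x y)\<^sup>2)" by simp
    then have "2 * \<bb> * card (trees V ?H) \<le> 2 * card (trees V E)"
      unfolding energy[symmetric] by (rule mult_right_mono) simp
    then have ratio: "\<bb> * card (trees V ?H) \<le> card (trees V E)" by simp
    have "{z. square_arcs z \<subseteq> E} \<subseteq> insert v {z. square_arcs z \<subseteq> ?H}"
    proof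
      fix z assume "z \<in> {z. square_arcs z \<subseteq> E}"
      then have z: "square_arcs z \<subseteq> E" by simp
      show "z \<in> insert v {z. square_arcs z \<subseteq> ?H}"
      proof (cases "(v, q) \<in> square_arcs z \<or> (q, v) \<in> square_arcs z")
        case True
        obtain x y where xy: "z = (x, y)" by (cases z)
        have "(z, (x - 1, y)) \<in> B" using squareB[OF z] by (auto simp: xy square_arcs_simp)
        then have "\<not> later v z" by (rule inB)
        then have "z = v" using True by (auto simp: xy square_arcs_simp later_def)
        then show ?thesis by simp
      qed (use z in \<open>auto simp: del_edge_def\<close>)
    qed
    then have "card {z. square_arcs z \<subseteq> E} \<le> card (insert v {z. square_arcs z \<subseteq> ?H})"
      using finite_squares[OF finite_subset[OF HE finE]] by (intro card_mono) auto
    also have "\<dots> \<le> Suc (card {z. square_arcs z \<subseteq> ?H})"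
      using finite_squares[OF finite_subset[OF HE finE]] by (simp add: card_insert_if)
    finally have "\<bb> ^ card {z. square_arcs z \<subseteq> E} \<le> \<bb> ^ Suc (card {z. square_arcs z \<subseteq> ?H})"
      by (rule power_increasing) (rule lattice_const_ge_1)
    moreover have "\<bb> ^ Suc (card {z. square_arcs z \<subseteq> ?H}) \<le> \<bb> * card (trees V ?H)"
      unfolding power_Suc by (rule mult_left_mono[OF IH]) (use lattice_const_ge_1 in linarith)
    ultimately show ?thesis using ratio by linarith
  qed
qed

section \<open>From arc sets to grid graphs\<close>

lemma connected_iff_connects:
  assumes "sym (parcs G)" and "parcs G \<subseteq> pverts G \<times> pverts G"
  shows "Digraph_Component.connected (with_proj G) \<longleftrightarrow> pverts G \<noteq> {} \<and> connects (pverts G) (parcs G)"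
proof -
  obtain V E where G: "G = \<lparr>pverts = V, parcs = E\<rparr>" by (cases G)
  have s: "sym E" and EV: "E \<subseteq> V \<times> V" using assms by (simp_all add: G)
  have "(\<Union>e\<in>E. {(fst e, snd e), (snd e, fst e)}) = E"
    using symD[OF s] by force
  then have "mk_symmetric (with_proj \<lparr>pverts = V, parcs = E\<rparr>) = \<lparr>pverts = V, parcs = E\<rparr>"
    by (simp add: mk_symmetric_def)
  moreover have "x \<rightarrow>\<^sup>*\<^bsub>with_proj \<lparr>pverts = V, parcs = E\<rparr>\<^esub> y \<longleftrightarrow> (x, y) \<in> E\<^sup>*" if "x \<in> V" "y \<in> V" for x y
  proof -
    have "(x, y) \<in> rtrancl_on V E" if "(x, y) \<in> E\<^sup>*"
      using rtrancl_consistent_rtrancl_on[OF that \<open>x \<in> V\<close> \<open>y \<in> V\<close>] EV by blast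
    then have "(x, y) \<in> rtrancl_on V E \<longleftrightarrow> (x, y) \<in> E\<^sup>*" using rtrancl_on_rtranclI by metis
    then show ?thesis by (simp add: reachable_def)
  qed
  ultimately show ?thesis
    by (auto simp: G Digraph_Component.connected_def strongly_connected_def connects_def)
qed

lemma cas_verts:
  assumes "pre_digraph.cas (with_proj H) c r u"
  shows "u \<in> set (pre_digraph.awalk_verts (with_proj H) c r)"
    and "c \<in> set (pre_digraph.awalk_verts (with_proj H) c r)"
    and "e \<in> set r \<Longrightarrow> fst e \<in> set (pre_digraph.awalk_verts (with_proj H) c r)
        \<and> snd e \<in> set (pre_digraph.awalk_verts (with_proj H) c r)"
proof -
  have "u \<in> set (pre_digraph.awalk_verts (with_proj H) c r) \<and> c \<in> set (pre_digraph.awalk_verts (with_proj H) c r)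
     \<and> (\<forall>e\<in>set r. fst e \<in> set (pre_digraph.awalk_verts (with_proj H) c r)
        \<and> snd e \<in> set (pre_digraph.awalk_verts (with_proj H) c r))"
    using assms
    by (induction r arbitrary: c) (auto simp: pre_digraph.cas.simps pre_digraph.awalk_verts.simps)
  then show "u \<in> set (pre_digraph.awalk_verts (with_proj H) c r)"
    "c \<in> set (pre_digraph.awalk_verts (with_proj H) c r)"
    "e \<in> set r \<Longrightarrow> fst e \<in> set (pre_digraph.awalk_verts (with_proj H) c r)
        \<and> snd e \<in> set (pre_digraph.awalk_verts (with_proj H) c r)" by auto
qed

lemma cas_rtrancl:
  assumes "pre_digraph.cas (with_proj H) c r u" "set r \<subseteq> R"
  shows "(c, u) \<in> R\<^sup>*"
  using assms
proof (induction r arbitrary: c)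
  case (Cons e r)
  then have "(c, snd e) \<in> R" by (cases e) (auto simp: pre_digraph.cas.simps)
  moreover have "(snd e, u) \<in> R\<^sup>*" using Cons by (auto simp: pre_digraph.cas.simps)
  ultimately show ?case by (rule converse_rtrancl_into_rtrancl)
qed (simp add: pre_digraph.cas.simps)

text \<open>
  The first arc \<open>(u, y)\<close> of a cycle of length at least 3 has the rest of the cycle as a detour that avoids it
  in both directions: the rest meets \<open>y\<close> only in its first arc, and that arc does not lead back to \<open>u\<close>.
\<close>

lemma no_long_cycle:
  assumes s: "sym T" and bridges: "\<And>x y. (x, y) \<in> T \<Longrightarrow> is_bridge T x y"
    and cyc: "pre_digraph.cycle (with_proj \<lparr>pverts = V, parcs = T\<rparr>) p" and len: "3 \<le> length p"
  shows False
proof -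
  let ?H = "\<lparr>pverts = V, parcs = T\<rparr>"
  let ?vs = "pre_digraph.awalk_verts (with_proj ?H)"
  note simps = pre_digraph.cas.simps pre_digraph.awalk_verts.simps with_proj_simps
  obtain a0 a1 a2 r where p: "p = a0 # a1 # a2 # r"
    using len by (auto simp: numeral_3_eq_3 Suc_le_length_iff)
  obtain u where walk: "set p \<subseteq> T" "pre_digraph.cas (with_proj ?H) u p u" and dist: "distinct (tl (?vs u p))"
    using cyc by (auto simp: pre_digraph.cycle_def pre_digraph.awalk_def)
  obtain y c where a: "a0 = (u, y)" "a1 = (y, c)" and tail: "pre_digraph.cas (with_proj ?H) c (a2 # r) u"
    using walk(2) unfolding p by (cases a0; cases a1) (auto simp: simps)
  have vs: "y \<notin> set (?vs c (a2 # r))" "distinct (?vs c (a2 # r))"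
    using dist unfolding p a by (auto simp: simps)
  have "u \<in> set (?vs (snd a2) r)" using cas_verts(1)[of ?H "snd a2" r u] tail by (simp add: simps)
  moreover have "fst a2 = c" using tail by (simp add: simps)
  ultimately have cu: "c \<noteq> u" using vs(2) by (auto simp: simps)
  have yc: "y \<noteq> c" using vs(1) cas_verts(2)[OF tail] by auto
  have "set (a2 # r) \<subseteq> del_edge T u y"
  proof
    fix e assume e: "e \<in> set (a2 # r)"
    then have "fst e \<noteq> y" "snd e \<noteq> y" using cas_verts(3)[OF tail e] vs(1) by auto
    then show "e \<in> del_edge T u y" using e walk(1) unfolding p by (auto simp: del_edge_def)
  qed
  then have "(c, u) \<in> (del_edge T u y)\<^sup>*" by (rule cas_rtrancl[OF tail])
  moreover have "(y, c) \<in> del_edge T u y"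
    using walk(1) cu yc unfolding p a by (auto simp: del_edge_def)
  ultimately have "(y, u) \<in> (del_edge T u y)\<^sup>*" by (rule converse_rtrancl_into_rtrancl[rotated])
  then have "(u, y) \<in> (del_edge T u y)\<^sup>*" by (rule sym_rtranclD[OF sym_edge_ops(1)[OF s]])
  moreover have "is_bridge T u y" using bridges walk(1) unfolding p a by auto
  ultimately show False by (simp add: is_bridge_def)
qed

lemma card_trees_le_num_spanning_trees:
  assumes G: "pair_graph G" and conn: "Digraph_Component.connected (with_proj G)"
  shows "card (trees (pverts G) (parcs G)) \<le> \<tau> G"
proof -
  interpret pair_graph G by (rule G)
  have s: "sym (parcs G)" using pair_sym_arcs by (simp add: symmetric_def)
  have EV: "parcs G \<subseteq> pverts G \<times> pverts G" using arc_fst_in_verts arc_snd_in_verts by force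
  have ne: "pverts G \<noteq> {}" using conn connected_iff_connects[OF s EV] by simp
  let ?f = "\<lambda>T. \<lparr>pverts = pverts G, parcs = T\<rparr>"
  have "?f ` trees (pverts G) (parcs G) \<subseteq> spanning_trees G"
  proof
    fix H assume "H \<in> ?f ` trees (pverts G) (parcs G)"
    then obtain T where H: "H = ?f T" and T: "T \<in> trees (pverts G) (parcs G)" by blast
    note t = treesD[OF T]
    have TV: "T \<subseteq> pverts G \<times> pverts G" using t(1) EV by blast
    have pg: "pair_graph H"
    proof
      show "symmetric (with_proj H)" using t(2) by (simp add: symmetric_def H)
      show "finite (parcs H)" using finite_subset[OF t(1) pair_finite_arcs] by (simp add: H)
    qed (use TV pair_finite_verts t(1) pair_no_loops in \<open>auto simp: H\<close>)
    interpret H: pair_graph H by (rule pg)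
    have "Digraph_Component.connected (with_proj H)"
      using connected_iff_connects[of H] t(2,3) TV ne by (simp add: H)
    moreover have "\<not> (\<exists>p. pre_digraph.cycle (with_proj H) p \<and> 3 \<le> length p)"
      using no_long_cycle[OF t(2)] t(4) unfolding H is_bridge_def by blast
    moreover have "spanning (with_proj H) (with_proj G)"
      unfolding spanning_def subgraph_def compatible_def
      using t(1) wf_digraph_axioms H.wf_digraph_axioms by (simp add: H)
    ultimately show "H \<in> spanning_trees G"
      using pg by (simp add: spanning_trees_def undirected_tree_def)
  qed
  moreover have "finite (spanning_trees G)"
  proof (rule finite_subset)
    show "spanning_trees G \<subseteq> ?f ` Pow (parcs G)"
    proof
      fix H assume "H \<in> spanning_trees G"
      then have "pverts H = pverts G" "parcs H \<subseteq> parcs G"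
        by (auto simp: spanning_trees_def spanning_def subgraph_def)
      then show "H \<in> ?f ` Pow (parcs G)" by (cases H) auto
    qed
  qed (use pair_finite_arcs in simp)
  moreover have "inj_on ?f (trees (pverts G) (parcs G))" by (simp add: inj_on_def)
  ultimately show ?thesis
    unfolding num_spanning_trees_def using card_inj_on_le by blast
qed

text \<open>
  The only integer solutions of \<open>m\<^sup>2 + n\<^sup>2 = 1\<close> are the four unit vectors.
\<close>

lemma unit_distance:
  assumes "dist (to_plane p) (to_plane q) = 1"
  shows "(p, q) \<in> lattice_arcs"
proof -
  obtain a b c d where pq: "p = (a, b)" "q = (c, d)" by (cases p; cases q)
  have "(of_int (a - c))\<^sup>2 + (of_int (b - d))\<^sup>2 = (1 :: real)"
    using assms by (simp add: pq to_plane_def dist_prod_def dist_real_def)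
  then have "of_int ((a - c)\<^sup>2 + (b - d)\<^sup>2) = (of_int 1 :: real)" by simp
  then have 1: "(a - c)\<^sup>2 + (b - d)\<^sup>2 = 1" by (simp only: of_int_eq_iff)
  have sq: "n \<in> {-1, 0, 1}" if "n\<^sup>2 \<le> 1" for n :: int
    using that abs_le_square_iff[of n 1] by auto
  have "(a - c)\<^sup>2 \<le> 1" "(b - d)\<^sup>2 \<le> 1" using 1 zero_le_power2[of "a - c"] zero_le_power2[of "b - d"] by linarith+
  then have "a - c \<in> {-1, 0, 1}" "b - d \<in> {-1, 0, 1}" using sq by blast+
  with 1 show ?thesis by (auto simp: pq lattice_arcs_def)
qed

theorem theorem5p1:
  fixes G :: "(int \<times> int) pair_pre_digraph"
  assumes "grid_graph G"
  shows "real (\<tau> G) \<ge> \<bb> ^ (card (pverts G) - card (top_left_boundary G))"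
proof -
  let ?V = "pverts G" and ?E = "parcs G"
  have G: "pair_graph G" and sub: "subgraph (with_proj G) (with_proj square_lattice)"
    and conn: "Digraph_Component.connected (with_proj G)"
    using assms by (auto simp: grid_graph_def)
  interpret pair_graph G by (rule G)
  have s: "sym ?E" using pair_sym_arcs by (simp add: symmetric_def)
  have EV: "?E \<subseteq> ?V \<times> ?V" using arc_fst_in_verts arc_snd_in_verts by force
  have lat: "?E \<subseteq> lattice_arcs"
    using sub unit_distance by (auto simp: subgraph_def square_lattice_def)
  have "connects ?V ?E" using conn connected_iff_connects[OF s EV] by simp
  then have bound: "\<bb> ^ card {v. square_arcs v \<subseteq> ?E} \<le> card (trees ?V ?E)"
    using grid_tree_bound[OF pair_finite_verts EV s lat] by simp
  have "?V - top_left_boundary G \<subseteq> {v. square_arcs v \<subseteq> ?E}"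
    by (auto simp: top_left_boundary_def subgraph_def square_arcs_def)
  then have "card (?V - top_left_boundary G) \<le> card {v. square_arcs v \<subseteq> ?E}"
    using finite_squares[OF pair_finite_arcs] by (rule card_mono[rotated])
  moreover have "card (?V - top_left_boundary G) = card ?V - card (top_left_boundary G)"
    by (rule card_Diff_subset) (use pair_finite_verts in \<open>auto simp: top_left_boundary_def\<close>)
  ultimately have "\<bb> ^ (card ?V - card (top_left_boundary G)) \<le> \<bb> ^ card {v. square_arcs v \<subseteq> ?E}"
    using lattice_const_ge_1 by (intro power_increasing) auto
  also have "\<dots> \<le> \<tau> G"
    using bound card_trees_le_num_spanning_trees[OF G conn] by linarith
  finally show ?thesis .
qed

end
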